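(* Let $n \in \{0, 1, \dots, 255\}$. The function $e^n : X \to X$ is a universal gate in $G$ (that is, $e^n$ is a gate and $G = \langle e^n, \sigma \rangle$) if and only if $n \in \{57, 99\}$.
   Context: Let $X = \{0,1\}^{\mathbb{Z}}$ with the product topology (discrete topology on $\{0,1\}$). The shift $\sigma : X \to X$ is $\sigma(x)_i = x_{i+1}$. A gate is a homeomorphism $f : X \to X$ for which there exists $r$ such that $f(x)_i = x_i$ for all $x \in X$ and all $|i| \geq r$. The group $G$ is the subgroup of the self-homeomorphism group of $X$ (under composition) generated by $\sigma$ and all gates. A gate $f$ is universal if $G = \langle f, \sigma \rangle$, the subgroup generated by $f$ and $\sigma$. Enumerate $\{0,1\}^3$ in reverse lexicographic order: $w_0 = 111$, $w_1 = 110$, $w_2 = 101$, $w_3 = 100$, $w_4 = 011$, $w_5 = 010$, $w_6 = 001$, $w_7 = 000$. For $n \in \{0,\dots,255\}$ with 8-digit binary expansion $n = (b_0 b_1 \cdots b_7)_2$ ($b_0$ the most significant bit), the map $e^n : X \to X$ is defined by $e^n(x)_0 = b_j$ where $j$ is such that $w_j = x_{-1}x_0x_1$, and $e^n(x)_i = x_i$ for $i \neq 0$. (The superscript $n$ is an index, the Wolfram number, not a power.) *)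

theory Defs
  imports "HOL-Analysis.Analysis" "HOL-Algebra.Generated_Groups"
begin

text \<open>
  Configurations are functions from \<open>int\<close> to \<open>bool\<close>, with \<open>True\<close> for the symbol 1.
  The topology on \<open>bool\<close> is discrete and the type class topology on a function type is the
  product topology, so the topological notions below refer to the Cantor topology.
\<close>

type_synonym config = "int \<Rightarrow> bool"

definition shift :: "config \<Rightarrow> config" where
  "shift x = (\<lambda>i. x (i + 1))"

definition is_homeo :: "(config \<Rightarrow> config) \<Rightarrow> bool" where
  "is_homeo f \<longleftrightarrow> (\<exists>g. homeomorphism UNIV UNIV f g)"

definition Homeo :: "(config \<Rightarrow> config) monoid" where
  "Homeo = \<lparr>carrier = {f. is_homeo f}, mult = (\<circ>), one = id\<rparr>"

definition gate :: "(config \<Rightarrow> config) \<Rightarrow> bool" where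
  "gate f \<longleftrightarrow> is_homeo f \<and> (\<exists>r::int. \<forall>x i. \<bar>i\<bar> \<ge> r \<longrightarrow> f x i = x i)"

definition gate_group :: "(config \<Rightarrow> config) set" where
  "gate_group = generate Homeo (insert shift {f. gate f})"

definition universal_gate :: "(config \<Rightarrow> config) \<Rightarrow> bool" where
  "universal_gate f \<longleftrightarrow> gate f \<and> gate_group = generate Homeo {f, shift}"

definition words :: "(bool \<times> bool \<times> bool) list" where
  "words =
    [(True, True, True), (True, True, False), (True, False, True), (True, False, False),
     (False, True, True), (False, True, False), (False, False, True), (False, False, False)]"

text \<open>
  The digit \<open>b\<^sub>j\<close> of the 8-digit binary expansion of \<open>n\<close>, counted from the most significant
  one, is the bit of weight \<open>2 ^ (7 - j)\<close>.
\<close>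

definition digit :: "nat \<Rightarrow> nat \<Rightarrow> bool" where
  "digit n j = bit n (7 - j)"

definition wolfram :: "nat \<Rightarrow> config \<Rightarrow> config" where
  "wolfram n x =
    x(0 := digit n (THE j. j < 8 \<and> words ! j = (x (- 1), x 0, x 1)))"

lemma is_homeo_id: "is_homeo id"
  unfolding is_homeo_def homeomorphism_def by (intro exI[of _ id]) auto

lemma is_homeo_comp: "is_homeo f \<Longrightarrow> is_homeo g \<Longrightarrow> is_homeo (f \<circ> g)"
  unfolding is_homeo_def using homeomorphism_compose by blast

lemma is_homeo_inverse: "is_homeo f \<Longrightarrow> \<exists>g. is_homeo g \<and> g \<circ> f = id"
  unfolding is_homeo_def
  by (metis UNIV_I comp_apply eq_id_iff homeomorphism_apply1 homeomorphism_symD)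

lemma group_Homeo: "group Homeo"
proof (rule groupI)
  fix f assume "f \<in> carrier Homeo"
  then show "\<exists>g\<in>carrier Homeo. g \<otimes>\<^bsub>Homeo\<^esub> f = \<one>\<^bsub>Homeo\<^esub>"
    using is_homeo_inverse[of f] by (auto simp: Homeo_def)
qed (auto simp: Homeo_def is_homeo_id is_homeo_comp comp_assoc)

end

theory Submission
  imports Defs "HOL-Combinatorics.Permutations"
begin

text \<open>
  Rule 57 flips \<open>b\<close> in \<open>abc\<close> unless \<open>(a, c) = (0, 1)\<close>. If \<open>f\<^sub>i\<close> is its translate to cell \<open>i\<close>,
  then \<open>(f\<^sub>1 f\<^sub>2)^4\<close> is a 3-cycle on the words of length 4. A commutator of two 3-cycles that act
  on overlapping windows and meet in a single word is again a 3-cycle, on the words of the larger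
  window. Hence, by induction on the window, every 3-cycle of words \<open>0s1\<close> is realized, and a
  comparison of the windows of lengths \<open>n\<close> and \<open>n + 1\<close> extends this to the other three pairs of
  boundary bits. A transposition of words acts on a larger window as an even permutation, so
  every permutation of words is realized; by compactness every gate is such a permutation.
  Rule 99 is the mirror image of rule 57. Any other elementary gate fixes \<open>0\<^sup>\<int>\<close>, fixes \<open>1\<^sup>\<int>\<close>, or
  is affine over the field with two elements, and each of these properties passes to the
  group it generates together with the shift.
\<close>

subsection \<open>Permutations of words acting on a window\<close>

definition window :: "int \<Rightarrow> nat \<Rightarrow> (int \<Rightarrow> 'a) \<Rightarrow> 'a list" where
  "window m n x = map (\<lambda>k. x (m + int k)) [0..<n]"

definition lift :: "int \<Rightarrow> nat \<Rightarrow> ('a list \<Rightarrow> 'a list) \<Rightarrow> (int \<Rightarrow> 'a) \<Rightarrow> int \<Rightarrow> 'a" where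
  "lift m n \<pi> x i = (if m \<le> i \<and> i < m + int n then \<pi> (window m n x) ! nat (i - m) else x i)"

lemma length_window [simp]: "length (window m n x) = n"
  by (simp add: window_def)

lemma nth_window [simp]: "k < n \<Longrightarrow> window m n x ! k = x (m + int k)"
  by (simp add: window_def)

lemma window_Suc_right: "window m (Suc n) x = window m n x @ [x (m + int n)]"
  by (simp add: window_def)

lemma window_Suc_left: "window m (Suc n) x = x m # window (m + 1) n x"
  by (rule nth_equalityI) (auto simp: nth_Cons algebra_simps split: nat.splits)

lemma window_lift:
  assumes "\<And>l. length l = n \<Longrightarrow> length (\<pi> l) = n"
  shows "window m n (lift m n \<pi> x) = \<pi> (window m n x)"
  by (rule nth_equalityI) (auto simp: lift_def assms)

lemma lift_comp:
  assumes "\<And>l. length l = n \<Longrightarrow> length (\<rho> l) = n"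
  shows "lift m n (\<lambda>l. \<pi> (\<rho> l)) = lift m n \<pi> \<circ> lift m n \<rho>"
  using assms by (auto simp: fun_eq_iff lift_def[of _ _ \<pi>] window_lift) (auto simp: lift_def)

lemma lift_cong:
  assumes "\<And>l. length l = n \<Longrightarrow> \<pi> l = \<rho> l"
  shows "lift m n \<pi> = lift m n \<rho>"
  by (simp add: fun_eq_iff lift_def assms)

text \<open>Padding by an inert letter does not change the action on configurations. Together with
  the analogue on the left, where the start of the window moves by one, this allows windows of
  lengths \<open>n\<close> and \<open>n + 1\<close> to be compared.\<close>

lemma lift_snoc:
  assumes "\<And>l. length l = n \<Longrightarrow> length (\<pi> l) = n"
  shows "lift m (Suc n) (\<lambda>l. \<pi> (butlast l) @ [last l]) = lift m n \<pi>"
proof (intro ext)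
  fix x i
  show "lift m (Suc n) (\<lambda>l. \<pi> (butlast l) @ [last l]) x i = lift m n \<pi> x i"
    by (cases "i = m + int n") (auto simp: lift_def window_Suc_right nth_append assms)
qed

lemma lift_Cons:
  assumes "\<And>l. length l = n \<Longrightarrow> length (\<pi> l) = n"
  shows "lift m (Suc n) (\<lambda>l. hd l # \<pi> (tl l)) = lift (m + 1) n \<pi>"
proof (intro ext)
  fix x i
  have "nat (i - m) - 1 = nat (i - (m + 1))"
    by simp
  then show "lift m (Suc n) (\<lambda>l. hd l # \<pi> (tl l)) x i = lift (m + 1) n \<pi> x i"
    by (cases "i = m") (auto simp: lift_def window_Suc_left nth_Cons')
qed

section \<open>3-cycles as commutators\<close>

definition cyc :: "'a \<Rightarrow> 'a \<Rightarrow> 'a \<Rightarrow> 'a \<Rightarrow> 'a" where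
  "cyc a b c z = (if z = a then b else if z = b then c else if z = c then a else z)"

text \<open>The supports of \<open>X\<close> and \<open>Y\<close> meet only in \<open>p\<close>.
  Hence \<open>X\<close> fixes \<open>Y p\<close> and \<open>Y' p\<close>, and \<open>Y\<close>
  fixes \<open>X p\<close> and \<open>X' p\<close>; following these points shows that
  \<open>p\<close> goes to \<open>X p\<close>, then to \<open>Y p\<close>, then back. Every other
  point returns to its place, since only one of the two maps acts along its path. The set
  \<open>W\<close> will consist of the words of one length.\<close>

lemma commutator_cyc:
  assumes maps: "\<And>z. z \<in> W \<Longrightarrow> X z \<in> W" "\<And>z. z \<in> W \<Longrightarrow> X' z \<in> W"
      "\<And>z. z \<in> W \<Longrightarrow> Y z \<in> W" "\<And>z. z \<in> W \<Longrightarrow> Y' z \<in> W"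
    and inv: "\<And>z. z \<in> W \<Longrightarrow> X (X' z) = z" "\<And>z. z \<in> W \<Longrightarrow> X' (X z) = z"
      "\<And>z. z \<in> W \<Longrightarrow> Y (Y' z) = z" "\<And>z. z \<in> W \<Longrightarrow> Y' (Y z) = z"
    and disj: "\<And>z. z \<in> W \<Longrightarrow> z \<noteq> p \<Longrightarrow> X z = z \<or> Y z = z"
    and p: "p \<in> W" "X p \<noteq> p" "Y p \<noteq> p" and z: "z \<in> W"
  shows "X (Y (X' (Y' z))) = cyc p (X p) (Y p) z"
proof -
  have inj: "X u = X v \<longleftrightarrow> u = v" "Y u = Y v \<longleftrightarrow> u = v" if "u \<in> W" "v \<in> W" for u v
    using inv(2)[OF that(1)] inv(2)[OF that(2)] inv(4)[OF that(1)] inv(4)[OF that(2)] by metis+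
  have YXp: "Y (X p) = X p" and XYp: "X (Y p) = Y p"
    using disj[of "X p"] disj[of "Y p"] inj[of "X p" p] inj[of "Y p" p] maps p by auto
  have fix': "X' u = u" if "u \<in> W" "X u = u" for u
    using inv(2)[OF that(1)] that(2) by simp
  have fiy': "Y' u = u" if "u \<in> W" "Y u = u" for u
    using inv(4)[OF that(1)] that(2) by simp
  consider "z = X p" | "z = Y p" | "z = p" | "z \<notin> {p, X p, Y p}" "X z = z" | "z \<notin> {p, X p, Y p}" "X z \<noteq> z"
    by blast
  then show ?thesis
  proof cases
    case 1
    then show ?thesis
      using fiy'[of "X p"] YXp XYp inv(2)[OF p(1)] maps(1)[OF p(1)] p by (simp add: cyc_def)
  next
    case 2
    have "Y (X' p) = X' p"
      using disj[of "X' p"] inv(1)[OF p(1)] maps(2)[OF p(1)] p by metis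
    moreover have "Y p \<noteq> X p"
      using XYp inj(1)[of "X p" p] maps(1)[OF p(1)] p by auto
    ultimately show ?thesis
      using 2 inv(4)[OF p(1)] inv(1)[OF p(1)] p by (simp add: cyc_def)
  next
    case 3
    have "X (Y' p) = Y' p"
      using disj[of "Y' p"] inv(3)[OF p(1)] maps(4)[OF p(1)] p by metis
    then show ?thesis
      using 3 fix'[of "Y' p"] maps(4)[OF p(1)] inv(3)[OF p(1)] by (simp add: cyc_def)
  next
    case 4
    have "Y' z \<noteq> p"
      using 4 inv(3)[OF z] by auto
    then have "X (Y' z) = Y' z \<or> Y (Y' z) = Y' z"
      using disj maps(4)[OF z] by blast
    then have "X (Y' z) = Y' z"
      using 4 inv(3)[OF z] by metis
    then show ?thesis
      using 4 fix'[OF maps(4)[OF z]] inv(3)[OF z] by (simp add: cyc_def)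
  next
    case 5
    have "Y z = z"
      using 5 disj[OF z] by auto
    have "X' z \<noteq> p"
      using 5 inv(1)[OF z] by auto
    then have "X (X' z) = X' z \<or> Y (X' z) = X' z"
      using disj maps(2)[OF z] by blast
    then have "Y (X' z) = X' z"
      using \<open>Y z = z\<close> inv(1)[OF z] by metis
    then show ?thesis
      using 5 fiy'[OF z \<open>Y z = z\<close>] inv(1)[OF z] by (simp add: cyc_def)
  qed
qed

text \<open>\<open>H\<close> is abstract because there are two instances: the group generated by
  rule 57 and the shift, and the reflected group of rule 99. Inverses arise by composition: each
  update is an involution, and the inverse of a 3-cycle is its square.\<close>

locale rule57 =
  fixes H :: "(config \<Rightarrow> config) set"
  assumes H_comp: "f \<in> H \<Longrightarrow> g \<in> H \<Longrightarrow> f \<circ> g \<in> H"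
    and H_step: "(\<lambda>x. x(i := (x i \<noteq> (x (i - 1) \<or> \<not> x (i + 1))))) \<in> H"
begin

text \<open>All offsets \<open>m\<close> are required at once, so that a letter can be added or
  dropped on the left as freely as on the right.\<close>

definition realized :: "nat \<Rightarrow> (bool list \<Rightarrow> bool list) \<Rightarrow> bool" where
  "realized n \<pi> \<longleftrightarrow> (\<forall>l. length l = n \<longrightarrow> length (\<pi> l) = n) \<and> (\<forall>m. lift m n \<pi> \<in> H)"

lemma realized_length: "realized n \<pi> \<Longrightarrow> length l = n \<Longrightarrow> length (\<pi> l) = n"
  by (simp add: realized_def)

lemma realized_comp: "realized n \<pi> \<Longrightarrow> realized n \<rho> \<Longrightarrow> realized n (\<lambda>l. \<pi> (\<rho> l))"
  by (simp add: realized_def lift_comp H_comp)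

lemma realized_cong:
  assumes "realized n \<pi>" "\<And>l. length l = n \<Longrightarrow> \<pi> l = \<rho> l"
  shows "realized n \<rho>"
proof -
  have "lift m n \<pi> = lift m n \<rho>" for m
    by (rule lift_cong) (rule assms(2))
  then show ?thesis
    using assms by (simp add: realized_def)
qed

lemma realized_snoc:
  assumes "\<And>l. length l = n \<Longrightarrow> length (\<pi> l) = n"
  shows "realized (Suc n) (\<lambda>l. \<pi> (butlast l) @ [last l]) \<longleftrightarrow> realized n \<pi>"
  using assms by (auto simp: realized_def lift_snoc)

lemma realized_Cons:
  assumes "\<And>l. length l = n \<Longrightarrow> length (\<pi> l) = n"
  shows "realized (Suc n) (\<lambda>l. hd l # \<pi> (tl l)) \<longleftrightarrow> realized n \<pi>"
  using assms by (auto simp: realized_def lift_Cons) (metis diff_add_cancel)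

definition upd :: "nat \<Rightarrow> bool list \<Rightarrow> bool list" where
  "upd k l = l[k := (l ! k \<noteq> (l ! (k - 1) \<or> \<not> l ! (k + 1)))]"

lemma length_upd [simp]: "length (upd k l) = length l"
  by (simp add: upd_def)

lemma upd_upd [simp]: "0 < k \<Longrightarrow> k + 1 < length l \<Longrightarrow> upd k (upd k l) = l"
  by (rule nth_equalityI) (auto simp: upd_def nth_list_update)

lemma realized_upd:
  assumes "0 < k" "k + 1 < n"
  shows "realized n (upd k)"
proof -
  have "lift m n (upd k) = (\<lambda>x. x(m + int k := (x (m + int k) \<noteq> (x (m + int k - 1) \<or> \<not> x (m + int k + 1)))))" for m
  proof (intro ext)
    fix x i
    show "lift m n (upd k) x i = (x(m + int k := (x (m + int k) \<noteq> (x (m + int k - 1) \<or> \<not> x (m + int k + 1))))) i"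
      using assms
      by (cases "i = m + int k") (auto simp: lift_def upd_def nth_list_update algebra_simps)
  qed
  then show ?thesis
    using H_step[of "m + int k" for m] by (simp add: realized_def)
qed


section \<open>Realized 3-cycles, their conjugates and commutators\<close>

definition cycle :: "bool list \<Rightarrow> bool list \<Rightarrow> bool list \<Rightarrow> bool" where
  "cycle a b c \<longleftrightarrow> length b = length a \<and> length c = length a \<and> distinct [a, b, c] \<and>
    realized (length a) (cyc a b c)"

lemma cycle_rotate:
  assumes "cycle a b c"
  shows "cycle b c a"
proof -
  have "cyc b c a = cyc a b c"
    using assms by (auto simp: cycle_def cyc_def fun_eq_iff)
  then show ?thesis
    using assms by (auto simp: cycle_def)
qed

text \<open>The square of a 3-cycle is its inverse.\<close>

lemma cycle_swap:
  assumes "cycle a b c"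
  shows "cycle b a c"
proof -
  have "(\<lambda>l. cyc a b c (cyc a b c l)) = cyc b a c"
    using assms by (auto simp: cycle_def cyc_def fun_eq_iff)
  then show ?thesis
    using assms realized_comp[of "length a" "cyc a b c" "cyc a b c"] by (auto simp: cycle_def)
qed

text \<open>Conjugation requires the inverse to be realized as well, so it is carried along
  explicitly. Cancellation is confined to words of length \<open>n\<close>: padding by
  \<open>butlast\<close> and \<open>last\<close>, for one, cancels only on nonempty words.\<close>

definition invertible :: "nat \<Rightarrow> (bool list \<Rightarrow> bool list) \<Rightarrow> (bool list \<Rightarrow> bool list) \<Rightarrow> bool" where
  "invertible n g g' \<longleftrightarrow> realized n g \<and> realized n g' \<and>
    (\<forall>l. length l = n \<longrightarrow> g (g' l) = l \<and> g' (g l) = l)"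

lemma invertible_sym: "invertible n g g' \<Longrightarrow> invertible n g' g"
  by (auto simp: invertible_def)

lemma invertible_length:
  assumes "invertible n g g'" "length l = n"
  shows "length (g l) = n" "length (g' l) = n"
  using assms by (auto simp: invertible_def realized_length)

lemma invertible_inj:
  "invertible n g g' \<Longrightarrow> length a = n \<Longrightarrow> length b = n \<Longrightarrow> g a = g b \<longleftrightarrow> a = b"
  by (metis invertible_def)

lemma invertible_comp:
  assumes g: "invertible n g g'" and h: "invertible n h h'"
  shows "invertible n (\<lambda>l. g (h l)) (\<lambda>l. h' (g' l))"
  using assms invertible_length[OF g] invertible_length[OF h] realized_comp[of n g h] realized_comp[of n h' g']
  by (auto simp: invertible_def)

lemma invertible_upd: "0 < k \<Longrightarrow> k + 1 < n \<Longrightarrow> invertible n (upd k) (upd k)"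
  by (simp add: invertible_def realized_upd)

lemma invertible_cyc:
  assumes "cycle a b c"
  shows "invertible (length a) (cyc a b c) (cyc c b a)"
proof -
  have "cycle c b a"
    using assms by (blast intro: cycle_rotate cycle_swap)
  then show ?thesis
    using assms by (auto simp: invertible_def cycle_def cyc_def)
qed

lemma invertible_snoc:
  assumes "invertible n g g'"
  shows "invertible (Suc n) (\<lambda>l. g (butlast l) @ [last l]) (\<lambda>l. g' (butlast l) @ [last l])"
proof -
  note [simp] = invertible_length[OF assms]
  have "realized (Suc n) (\<lambda>l. g (butlast l) @ [last l])" "realized (Suc n) (\<lambda>l. g' (butlast l) @ [last l])"
    using assms by (auto simp: realized_snoc invertible_def)
  moreover have "butlast l @ [last l] = l" if "length l = Suc n" for l :: "bool list"
    using that by (intro append_butlast_last_id) auto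
  ultimately show ?thesis
    using assms by (auto simp: invertible_def)
qed

lemma invertible_Cons:
  assumes "invertible n g g'"
  shows "invertible (Suc n) (\<lambda>l. hd l # g (tl l)) (\<lambda>l. hd l # g' (tl l))"
proof -
  note [simp] = invertible_length[OF assms]
  have "realized (Suc n) (\<lambda>l. hd l # g (tl l))" "realized (Suc n) (\<lambda>l. hd l # g' (tl l))"
    using assms by (auto simp: realized_Cons invertible_def)
  moreover have "hd l # tl l = l" if "length l = Suc n" for l :: "bool list"
    using that by (intro list.collapse) auto
  ultimately show ?thesis
    using assms by (auto simp: invertible_def)
qed

lemma cycle_image:
  assumes g: "invertible n g g'" and c: "cycle a b c" and n: "length a = n"
  shows "cycle (g a) (g b) (g c)"
proof -
  note len = invertible_length[OF g] and inj = invertible_inj[OF g]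
  have l: "length b = n" "length c = n" "distinct [a, b, c]" and r: "realized n (cyc a b c)"
    using c n by (auto simp: cycle_def)
  have "realized n g" "realized n g'"
    using g by (simp_all add: invertible_def)
  then have "realized n (\<lambda>l. g (cyc a b c (g' l)))"
    by (rule realized_comp[OF _ realized_comp[OF r]])
  moreover have "g (cyc a b c (g' l)) = cyc (g a) (g b) (g c) l" if "length l = n" for l
  proof -
    have *: "g' l = z \<longleftrightarrow> l = g z" if "length z = n" for z
      using g that \<open>length l = n\<close> by (auto simp: invertible_def)
    have "g (g' l) = l"
      using g that by (simp add: invertible_def)
    then show ?thesis
      by (simp add: cyc_def * l n)
  qed
  ultimately have "realized n (cyc (g a) (g b) (g c))"
    by (rule realized_cong)
  then show ?thesis
    using l n by (simp add: cycle_def len inj)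
qed

lemma cycle_commutator:
  assumes X: "invertible n X X'" and Y: "invertible n Y Y'"
    and disj: "\<And>z. length z = n \<Longrightarrow> z \<noteq> p \<Longrightarrow> X z = z \<or> Y z = z"
    and p: "length p = n" "X p \<noteq> p" "Y p \<noteq> p"
  shows "cycle p (X p) (Y p)"
proof -
  note lX = invertible_length[OF X] and lY = invertible_length[OF Y]
  have inv: "X (X' l) = l" "X' (X l) = l" "Y (Y' l) = l" "Y' (Y l) = l" if "length l = n" for l
    using X Y that by (simp_all add: invertible_def)
  have "realized n X" "realized n X'" "realized n Y" "realized n Y'"
    using X Y by (simp_all add: invertible_def)
  note realized_comp[OF this(1) realized_comp[OF this(3) realized_comp[OF this(2,4)]]]
  moreover have "X (Y (X' (Y' z))) = cyc p (X p) (Y p) z" if "length z = n" for z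
    by (rule commutator_cyc[where W = "{l. length l = n}"])
      (simp_all add: lX lY inv disj p that)
  ultimately have "realized n (cyc p (X p) (Y p))"
    by (rule realized_cong)
  \<comment> \<open>\<open>X p\<close> is moved by \<open>X\<close> and hence fixed by
    \<open>Y\<close>, whereas \<open>Y p\<close> is moved by \<open>Y\<close>.\<close>
  moreover have "X p \<noteq> Y p"
    using disj[of "X p"] p lX invertible_inj[OF X] invertible_inj[OF Y] by metis
  ultimately show ?thesis
    using p by (auto simp: cycle_def lX lY)
qed

section \<open>Sets of words on which all 3-cycles are realized\<close>

definition alternating :: "bool list set \<Rightarrow> bool" where
  "alternating S \<longleftrightarrow> (\<forall>a\<in>S. \<forall>b\<in>S. \<forall>c\<in>S. distinct [a, b, c] \<longrightarrow> cycle a b c)"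

lemma alternatingD: "alternating S \<Longrightarrow> a \<in> S \<Longrightarrow> b \<in> S \<Longrightarrow> c \<in> S \<Longrightarrow> distinct [a, b, c] \<Longrightarrow> cycle a b c"
  by (auto simp: alternating_def)

lemma alternating_subset: "alternating S \<Longrightarrow> T \<subseteq> S \<Longrightarrow> alternating T"
  by (auto simp: alternating_def)

text \<open>The 3-cycles through two given points generate the alternating group. Conjugating one of
  them by another replaces \<open>p\<close> or \<open>q\<close> by a further point; this yields
  first the cycles through just one of \<open>p\<close> and \<open>q\<close>, then those avoiding
  both.\<close>

lemma alternating_star:
  assumes pq: "p \<noteq> q" and star: "\<And>z. z \<in> S \<Longrightarrow> z \<noteq> p \<Longrightarrow> z \<noteq> q \<Longrightarrow> cycle p q z"
  shows "alternating S"
proof -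
  have conj: "cycle (cyc u v w a) (cyc u v w b) (cyc u v w c)"
    if "cycle u v w" "cycle a b c" "length a = length u" for u v w a b c
    using cycle_image[OF invertible_cyc] that by metis
  have len: "length z = length p" "length q = length p" if "z \<in> S" "z \<noteq> p" "z \<noteq> q" for z
    using star[OF that] by (auto simp: cycle_def)
  have q2: "cycle q z w" if "z \<in> S" "z \<noteq> p" "z \<noteq> q" "w \<in> S" "w \<noteq> p" "w \<noteq> q" "z \<noteq> w" for z w
    using conj[of p q z p q w] star that pq by (auto simp: cyc_def)
  have p2: "cycle p z w" if "z \<in> S" "z \<noteq> p" "z \<noteq> q" "w \<in> S" "w \<noteq> p" "w \<noteq> q" "z \<noteq> w" for z w
    using conj[of q p z q p w] cycle_swap[OF star] that pq by (auto simp: cyc_def)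
  have n2: "cycle v z w" if "z \<in> S" "z \<noteq> p" "z \<noteq> q" "w \<in> S" "w \<noteq> p" "w \<noteq> q" "z \<noteq> w"
      "v \<in> S" "v \<noteq> p" "v \<noteq> q" "v \<noteq> z" "v \<noteq> w" for z w v
    using conj[of p q v q z w] q2[of z w] star[of v] len[of v] that pq by (auto simp: cyc_def)
  show ?thesis
    unfolding alternating_def
  proof (intro ballI impI)
    fix a b c
    assume S: "a \<in> S" "b \<in> S" "c \<in> S" and d: "distinct [a, b, c]"
    have 1: "cycle a b c" if "a = p \<or> a = q" "a \<in> S" "b \<in> S" "c \<in> S" "distinct [a, b, c]" for a b c
      using that star q2 p2 pq cycle_rotate cycle_swap by (metis distinct_length_2_or_more)
    consider "a = p \<or> a = q" | "b = p \<or> b = q" | "c = p \<or> c = q" | "{p, q} \<inter> {a, b, c} = {}"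
      by auto
    then show "cycle a b c"
    proof cases
      case 2
      then have "cycle b c a" using 1 S d by auto
      then show ?thesis by (blast intro: cycle_rotate)
    next
      case 3
      then have "cycle c a b" using 1 S d by auto
      then show ?thesis by (blast intro: cycle_rotate)
    qed (use 1 n2 S d in auto)
  qed
qed

text \<open>Two common points serve as the centre of a star that reaches both sets.\<close>

lemma alternating_Un:
  assumes "alternating S" "alternating T" "p \<in> S \<inter> T" "q \<in> S \<inter> T" "p \<noteq> q"
  shows "alternating (S \<union> T)"
proof (rule alternating_star[of p q])
  fix z assume "z \<in> S \<union> T" "z \<noteq> p" "z \<noteq> q"
  then show "cycle p q z"
    using alternatingD[OF assms(1), of p q z] alternatingD[OF assms(2), of p q z] assms by auto
qed fact

lemma alternating_triple: "cycle a b c \<Longrightarrow> alternating {a, b, c}"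
  by (rule alternating_star[of a b]) (auto simp: cycle_def)

text \<open>Fix one representative of each set. Any two of them are the centre of a star over the
  third set, and the three stars share enough representatives to be glued.\<close>

lemma alternating_tripartite:
  assumes "\<And>a b c. a \<in> A \<Longrightarrow> b \<in> B \<Longrightarrow> c \<in> C \<Longrightarrow> cycle a b c"
    and "A \<noteq> {}" "B \<noteq> {}" "C \<noteq> {}"
  shows "alternating (A \<union> B \<union> C)"
proof -
  obtain a b c where m: "a \<in> A" "b \<in> B" "c \<in> C"
    using assms by blast
  then have ne: "a \<noteq> b" "a \<noteq> c" "b \<noteq> c"
    using assms(1)[OF m] by (auto simp: cycle_def)
  have "alternating ({a, b} \<union> C)"
    by (rule alternating_star[of a b]) (use assms(1) m ne in auto)
  moreover have "alternating ({a, c} \<union> B)"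
    by (rule alternating_star[of a c]) (use cycle_swap[OF cycle_rotate[OF cycle_rotate[OF assms(1)]]] m ne in auto)
  ultimately have "alternating ({a, b} \<union> C \<union> ({a, c} \<union> B))"
    by (rule alternating_Un[of _ _ a c]) (use m ne in auto)
  moreover have "alternating ({b, c} \<union> A)"
    by (rule alternating_star[of b c]) (use cycle_rotate[OF assms(1)] m ne in auto)
  ultimately have "alternating ({a, b} \<union> C \<union> ({a, c} \<union> B) \<union> ({b, c} \<union> A))"
    by (rule alternating_Un[of _ _ b c]) (use m ne in auto)
  then show ?thesis
    by (rule alternating_subset) (use m in auto)
qed

lemma alternating_image:
  assumes "invertible n g g'" "alternating S" "\<And>a. a \<in> S \<Longrightarrow> length a = n"
  shows "alternating (g ` S)"
  unfolding alternating_def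
proof (intro ballI impI)
  fix a b c assume "a \<in> g ` S" "b \<in> g ` S" "c \<in> g ` S" and d: "distinct [a, b, c]"
  then obtain a' b' c' where eq: "a = g a'" "b = g b'" "c = g c'" and S: "a' \<in> S" "b' \<in> S" "c' \<in> S"
    by blast
  have "cycle a' b' c'"
    by (rule alternatingD[OF assms(2) S]) (use d eq in auto)
  then show "cycle a b c"
    unfolding eq by (rule cycle_image[OF assms(1) _ assms(3)[OF S(1)]])
qed

text \<open>An update with two fixed points in \<open>S\<close> carries \<open>S\<close> to a set
  sharing these points, so the two sets merge. This is how the set of reachable words is enlarged
  below.\<close>

lemma alternating_upd:
  assumes S: "alternating S" "\<And>a. a \<in> S \<Longrightarrow> length a = n" and k: "0 < k" "k + 1 < n"
    and "p \<in> S" "q \<in> S" "p \<noteq> q" "upd k p = p" "upd k q = q"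
  shows "alternating (S \<union> upd k ` S)"
proof (rule alternating_Un[of _ _ p q])
  show "alternating (upd k ` S)"
    by (rule alternating_image[OF invertible_upd]) (use assms in auto)
  show "p \<in> S \<inter> upd k ` S" "q \<in> S \<inter> upd k ` S"
    using assms by (metis IntI imageI)+
qed (use assms in auto)

subsection \<open>Three-cycles of words with prescribed boundary bits\<close>

text \<open>Updates at interior letters are controlled by the outer letters but never change them,
  so each pair of boundary bits is treated as a class of its own.\<close>

definition middle :: "nat \<Rightarrow> bool \<Rightarrow> bool \<Rightarrow> bool list set" where
  "middle n \<alpha> \<beta> = {\<alpha> # s @ [\<beta>] | s. length s = n}"

lemma length_middle: "a \<in> middle n \<alpha> \<beta> \<Longrightarrow> length a = n + 2"
  by (auto simp: middle_def)

text \<open>One cycle acts on all letters but the last, the other on all letters but the first. By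
  \<open>disj\<close>, words of the two triples fit together only as \<open>a @ [y]\<close>, so this
  is the only word moved by both, and the commutator is a 3-cycle.\<close>

lemma cycle_overlap:
  assumes abc: "cycle a b c" and abc': "cycle a' b' c'" and len: "length a' = length a"
    and p: "a @ [y] = x # a'" and ne: "a \<noteq> []"
    and disj: "\<And>z z' t t'. z \<in> {a, b, c} \<Longrightarrow> z' \<in> {a', b', c'} \<Longrightarrow> z @ [t] = t' # z' \<Longrightarrow> z = a \<and> z' = a'"
  shows "cycle (a @ [y]) (b @ [y]) (x # b')"
proof -
  define X where "X l = cyc a b c (butlast l) @ [last l]" for l
  define Y where "Y l = hd l # cyc a' b' c' (tl l)" for l
  have X: "invertible (Suc (length a)) X (\<lambda>l. cyc c b a (butlast l) @ [last l])"
    using invertible_snoc[OF invertible_cyc[OF abc]] by (simp add: X_def[abs_def])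
  have Y: "invertible (Suc (length a)) Y (\<lambda>l. hd l # cyc c' b' a' (tl l))"
    using invertible_Cons[OF invertible_cyc[OF abc']] len by (simp add: Y_def[abs_def])
  have "X z = z \<or> Y z = z" if z: "length z = Suc (length a)" "z \<noteq> a @ [y]" for z
  proof (rule ccontr)
    assume not: "\<not> (X z = z \<or> Y z = z)"
    have bl: "butlast z @ [last z] = z" and ht: "hd z # tl z = z"
      using z by (auto intro: append_butlast_last_id list.collapse)
    then have "butlast z \<in> {a, b, c}" "tl z \<in> {a', b', c'}"
      using not by (auto simp: X_def Y_def cyc_def split: if_splits)
    from disj[OF this, of "last z" "hd z"] have *: "butlast z = a" "tl z = a'"
      using bl ht by simp_all
    then have "last z = last a'" "y = last a'"
      using bl ht p ne len by (metis last_ConsR length_0_conv last_snoc)+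
    then show False
      using * bl z by simp
  qed
  moreover have Xp: "X (a @ [y]) = b @ [y]"
    by (simp add: X_def cyc_def)
  moreover have Yp: "Y (a @ [y]) = x # b'"
    by (simp add: Y_def cyc_def p)
  moreover have "b \<noteq> a" "b' \<noteq> a'"
    using abc abc' by (auto simp: cycle_def)
  then have "b @ [y] \<noteq> a @ [y]" "x # b' \<noteq> a @ [y]"
    by simp (simp add: p \<open>b' \<noteq> a'\<close>)
  ultimately show ?thesis
    using cycle_commutator[OF X Y, of "a @ [y]"] by simp
qed

lemma cyc_snoc:
  fixes l :: "bool list"
  assumes "y' \<noteq> y" "l \<noteq> []"
  shows "cyc u v w (butlast l) @ [last l] =
    cyc (u @ [y]) (v @ [y]) (w @ [y]) (cyc (u @ [y']) (v @ [y']) (w @ [y']) l)"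
  using assms by (cases l rule: rev_cases) (auto simp: cyc_def)

lemma cyc_Cons:
  fixes l :: "bool list"
  assumes "y' \<noteq> y" "l \<noteq> []"
  shows "hd l # cyc u v w (tl l) =
    cyc (y # u) (y # v) (y # w) (cyc (y' # u) (y' # v) (y' # w) l)"
  using assms by (cases l) (auto simp: cyc_def)

text \<open>The two cycles have disjoint supports, one for each value of the extra letter; their
  product is the cycle that ignores this letter.\<close>

lemma cycle_join_snoc:
  assumes "cycle (u @ [y]) (v @ [y]) (w @ [y])" "cycle (u @ [y']) (v @ [y']) (w @ [y'])" "y' \<noteq> y"
  shows "cycle u v w"
proof -
  have l: "length v = length u" "length w = length u" "distinct [u, v, w]"
    using assms by (auto simp: cycle_def)
  then have 1: "length (cyc u v w l) = length u" if "length l = length u" for l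
    using that by (auto simp: cyc_def)
  have "realized (Suc (length u))
      (\<lambda>l. cyc (u @ [y]) (v @ [y]) (w @ [y]) (cyc (u @ [y']) (v @ [y']) (w @ [y']) l))"
    by (rule realized_comp[of _ "cyc (u @ [y]) (v @ [y]) (w @ [y])"]) (use assms in \<open>simp_all add: cycle_def\<close>)
  then have "realized (Suc (length u)) (\<lambda>l. cyc u v w (butlast l) @ [last l])"
    by (rule realized_cong) (rule cyc_snoc[OF assms(3), symmetric], auto)
  then show ?thesis
    using l realized_snoc[of "length u" "cyc u v w", OF 1] by (simp add: cycle_def)
qed

lemma cycle_join_Cons:
  assumes "cycle (y # u) (y # v) (y # w)" "cycle (y' # u) (y' # v) (y' # w)" "y' \<noteq> y"
  shows "cycle u v w"
proof -
  have l: "length v = length u" "length w = length u" "distinct [u, v, w]"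
    using assms by (auto simp: cycle_def)
  then have 1: "length (cyc u v w l) = length u" if "length l = length u" for l
    using that by (auto simp: cyc_def)
  have "realized (Suc (length u))
      (\<lambda>l. cyc (y # u) (y # v) (y # w) (cyc (y' # u) (y' # v) (y' # w) l))"
    by (rule realized_comp[of _ "cyc (y # u) (y # v) (y # w)"]) (use assms in \<open>simp_all add: cycle_def\<close>)
  then have "realized (Suc (length u)) (\<lambda>l. hd l # cyc u v w (tl l))"
    by (rule realized_cong) (rule cyc_Cons[OF assms(3), symmetric], auto)
  then show ?thesis
    using l realized_Cons[of "length u" "cyc u v w", OF 1] by (simp add: cycle_def)
qed

text \<open>Conversely, the cycle that ignores the last letter acts at both of its values.
  Cancelling the part at \<open>y'\<close> by the inverse cycle \<open>?Z\<close> leaves the part at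
  \<open>y\<close>.\<close>

lemma cycle_split_snoc:
  assumes c: "cycle u v w" and c': "cycle (u @ [y']) (v @ [y']) (w @ [y'])" and "y' \<noteq> y"
  shows "cycle (u @ [y]) (v @ [y]) (w @ [y])"
proof -
  let ?Z = "cyc (w @ [y']) (v @ [y']) (u @ [y'])"
  have "realized (Suc (length u)) ?Z"
    using invertible_cyc[OF c'] by (simp add: invertible_def)
  moreover have "realized (Suc (length u)) (\<lambda>l. cyc u v w (butlast l) @ [last l])"
    using invertible_snoc[OF invertible_cyc[OF c]] by (simp add: invertible_def)
  ultimately have "realized (Suc (length u)) (\<lambda>l. cyc u v w (butlast (?Z l)) @ [last (?Z l)])"
    by - (rule realized_comp[of _ "\<lambda>l. cyc u v w (butlast l) @ [last l]" ?Z])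
  moreover have "cyc u v w (butlast (?Z l)) @ [last (?Z l)] = cyc (u @ [y]) (v @ [y]) (w @ [y]) l"
    if "length l = Suc (length u)" for l
    using that assms by (cases l rule: rev_cases) (auto simp: cyc_def cycle_def)
  ultimately have "realized (Suc (length u)) (cyc (u @ [y]) (v @ [y]) (w @ [y]))"
    by (rule realized_cong)
  then show ?thesis
    using c by (auto simp: cycle_def)
qed

lemma cycle_split_Cons:
  assumes c: "cycle u v w" and c': "cycle (y' # u) (y' # v) (y' # w)" and "y' \<noteq> y"
  shows "cycle (y # u) (y # v) (y # w)"
proof -
  let ?Z = "cyc (y' # w) (y' # v) (y' # u)"
  have "realized (Suc (length u)) ?Z"
    using invertible_cyc[OF c'] by (simp add: invertible_def)
  moreover have "realized (Suc (length u)) (\<lambda>l. hd l # cyc u v w (tl l))"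
    using invertible_Cons[OF invertible_cyc[OF c]] by (simp add: invertible_def)
  ultimately have "realized (Suc (length u)) (\<lambda>l. hd (?Z l) # cyc u v w (tl (?Z l)))"
    by - (rule realized_comp[of _ "\<lambda>l. hd l # cyc u v w (tl l)" ?Z])
  moreover have "hd (?Z l) # cyc u v w (tl (?Z l)) = cyc (y # u) (y # v) (y # w) l"
    if "length l = Suc (length u)" for l
    using that assms by (cases l) (auto simp: cyc_def cycle_def)
  ultimately have "realized (Suc (length u)) (cyc (y # u) (y # v) (y # w))"
    by (rule realized_cong)
  then show ?thesis
    using c by (auto simp: cycle_def)
qed

text \<open>For boundary bits 0 and 1 the product \<open>?g\<close> of the two updates is a 3-cycle
  with one fixed word. For equal boundary bits it is a 4-cycle, and for boundary bits 1 and 0 an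
  involution. The fourth power therefore leaves only the 3-cycle.\<close>

lemma cycle_four:
  "cycle [False, False, False, True] [False, True, True, True] [False, True, False, True]"
proof -
  let ?g = "\<lambda>l. upd (Suc 0) (upd 2 l)"
  have g: "realized 4 ?g"
    using realized_comp[OF realized_upd realized_upd, of "Suc 0" 4 2] by simp
  have "realized 4 (\<lambda>l. ?g (?g (?g (?g l))))"
    using realized_comp[OF g realized_comp[OF g realized_comp[OF g g]]] .
  moreover have "?g (?g (?g (?g l))) =
      cyc [False, False, False, True] [False, True, False, True] [False, True, True, True] l"
    if "length l = 4" for l
  proof -
    obtain a b c d where "l = [a, b, c, d]"
      using \<open>length l = 4\<close> by (auto simp: length_Suc_conv numeral_eq_Suc)
    then show ?thesis
      by (cases a; cases b; cases c; cases d; simp add: upd_def cyc_def numeral_eq_Suc)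
  qed
  ultimately have "realized 4 (cyc [False, False, False, True] [False, True, False, True] [False, True, True, True])"
    by (rule realized_cong)
  then have "cycle [False, False, False, True] [False, True, False, True] [False, True, True, True]"
    by (simp add: cycle_def numeral_eq_Suc)
  then show ?thesis
    by (blast intro: cycle_rotate cycle_swap)
qed

lemma length_five: "length l = 5 \<Longrightarrow> \<exists>a b c d e. l = [a, b, c, d, e]"
  by (auto simp: length_Suc_conv numeral_eq_Suc)

text \<open>The two overlapping copies of the 3-cycle of \<open>cycle_four\<close> have disjoint
  supports among the words of length 5. After the left copy is conjugated by three updates, the
  supports meet in 00001 alone, and the commutator is a first 3-cycle of words
  \<open>0bcd1\<close>.\<close>

lemma alternating_base: "alternating (middle 3 False True)"
proof -
  let ?a = "[False, False, False, True]" and ?b = "[False, True, True, True]" and ?c = "[False, True, False, True]"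
  let ?w = "\<lambda>b c d. [False, b, c, d, True]"
  define X where "X l = upd 1 (upd 2 (upd 3 ((\<lambda>l. cyc ?a ?b ?c (butlast l) @ [last l]) (upd 3 (upd 2 (upd 1 l))))))" for l
  define X' where "X' l = upd 1 (upd 2 (upd 3 ((\<lambda>l. cyc ?c ?b ?a (butlast l) @ [last l]) (upd 3 (upd 2 (upd 1 l))))))" for l
  define Y where "Y l = hd l # cyc ?a ?b ?c (tl l)" for l
  have u: "invertible 5 (upd 1) (upd 1)" "invertible 5 (upd 2) (upd 2)" "invertible 5 (upd 3) (upd 3)"
    by (simp_all add: invertible_upd)
  have s: "invertible 5 (\<lambda>l. cyc ?a ?b ?c (butlast l) @ [last l]) (\<lambda>l. cyc ?c ?b ?a (butlast l) @ [last l])"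
    using invertible_snoc[OF invertible_cyc[OF cycle_four]] by (simp add: numeral_eq_Suc)
  have "invertible 5 (\<lambda>l. upd 1 (upd 2 (upd 3 l))) (\<lambda>l. upd 3 (upd 2 (upd 1 l)))"
    using invertible_comp[OF u(1) invertible_comp[OF u(2,3)]] .
  note v = this invertible_sym[OF this]
  have X: "invertible 5 X X'"
    using invertible_comp[OF v(1) invertible_comp[OF s v(2)]] by (simp add: X_def[abs_def] X'_def[abs_def])
  have Y: "invertible 5 Y (\<lambda>l. hd l # cyc ?c ?b ?a (tl l))"
    using invertible_Cons[OF invertible_cyc[OF cycle_four]] by (simp add: Y_def[abs_def] numeral_eq_Suc)
  have disj: "X z = z \<or> Y z = z" if "length z = 5" "z \<noteq> ?w False False False" for z
  proof -
    obtain a b c d e where "z = [a, b, c, d, e]"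
      using length_five[OF \<open>length z = 5\<close>] by blast
    then show ?thesis
      using that
      by (cases a; cases b; cases c; cases d; cases e; simp add: X_def Y_def upd_def cyc_def numeral_eq_Suc)
  qed
  have XY: "X (?w False False False) = ?w True True True" "X (?w True True True) = ?w True False True"
      "X (?w False True True) = ?w False True True"
      "Y (?w False False False) = ?w False True True" "Y (?w False True True) = ?w False True False"
      "Y (?w True True True) = ?w True True True"
    by (simp_all add: X_def Y_def upd_def cyc_def numeral_eq_Suc)
  have "cycle (?w False False False) (?w True True True) (?w False True True)"
    using cycle_commutator[OF X Y, of "?w False False False"] disj by (simp add: XY)
  then have 0: "alternating {?w False False False, ?w True True True, ?w False True True}" (is "alternating ?S")
    by (rule alternating_triple)
  have "alternating (X ` ?S)" "alternating (Y ` ?S)"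
    by (rule alternating_image[OF X 0] alternating_image[OF Y 0]; auto)+
  \<comment> \<open>The triple and both of its images contain 01111 and 00111, which permits the
    gluing.\<close>
  then have "alternating (?S \<union> X ` ?S \<union> Y ` ?S)"
    using 0 by (intro alternating_Un[of _ _ "?w True True True" "?w False True True"]) (auto simp: XY)
  then have 1: "alternating {?w False False False, ?w True True True, ?w False True True, ?w True False True, ?w False True False}"
      (is "alternating ?T")
    by (rule alternating_subset) (auto simp: XY)
  \<comment> \<open>The update at letter 1 adds 01001 and 00011; afterwards the update at letter 3
    adds the last missing word 01101.\<close>
  have "alternating (?T \<union> upd 1 ` ?T)"
    by (rule alternating_upd[OF 1, of 5 _ "?w True True True" "?w False True True"]) (auto simp: upd_def)
  then have 2: "alternating (?T \<union> {?w True False False, ?w False False True})" (is "alternating ?U")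
    by (rule alternating_subset) (auto simp: upd_def)
  have "alternating (?U \<union> upd 3 ` ?U)"
    by (rule alternating_upd[OF 2, of 5 _ "?w False False False" "?w True False True"]) (auto simp: upd_def numeral_eq_Suc)
  then show ?thesis
  proof (rule alternating_subset, intro subsetI)
    fix l assume "l \<in> middle 3 False True"
    then obtain b c d where "l = ?w b c d"
      by (auto simp: middle_def length_Suc_conv numeral_eq_Suc)
    then show "l \<in> ?U \<union> upd 3 ` ?U"
      by (cases b; cases c; cases d) (auto simp: upd_def numeral_eq_Suc)
  qed
qed

lemma other_list:
  assumes "0 < length s"
  obtains s' :: "bool list" where "length s' = length s" "s' \<noteq> s"
  using assms by (cases s) (auto intro: that[of "(\<not> hd s) # tl s"])

text \<open>
  Commutators give all 3-cycles on the words \<open>0s1\<close> except those meeting the words \<open>01t01\<close>;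
  these words are reached by conjugation with the rule at cells 1 and 2.
\<close>

lemma alternating_Suc:
  assumes n: "2 \<le> n" and compl: "alternating (middle (Suc n) False True)"
  shows "alternating (middle (Suc (Suc n)) False True)"
proof -
  \<comment> \<open>Among the words \<open>0s1\<close>, dropping the last letter leaves boundary
    bits 0, 1 exactly on the words ending in 11, and dropping the first exactly on those starting
    with 00. Both hold on \<open>A\<close>, where the two shorter cycles will meet.\<close>
  define A where "A = {False # False # r @ [True, True] | r. length r = n}"
  define B where "B = {False # True # s @ [True, True] | s. length s = n}"
  define D where "D = {False # False # t @ [False, True] | t. length t = n}"
  have tri: "cycle a b d" if m: "a \<in> A" "b \<in> B" "d \<in> D" for a b d
  proof -
    obtain r s t where r: "a = False # False # r @ [True, True]" "length r = n"
      and s: "b = False # True # s @ [True, True]" "length s = n"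
      and t: "d = False # False # t @ [False, True]" "length t = n"
      using m by (auto simp: A_def B_def D_def)
    \<comment> \<open>The third word of each shorter cycle is arbitrary; it does not occur in the
      commutator.\<close>
    obtain s' where s': "length s' = n" "s' \<noteq> s"
      using other_list[of s] s n by auto
    obtain t' where t': "length t' = n" "t' \<noteq> t"
      using other_list[of t] t n by auto
    have 1: "cycle (False # False # r @ [True]) (False # True # s @ [True]) (False # True # s' @ [True])"
      by (rule alternatingD[OF compl]) (use r s s' in \<open>auto simp: middle_def intro: exI[of _ "_ # _"]\<close>)
    have 2: "cycle (False # r @ [True, True]) (False # t @ [False, True]) (False # t' @ [False, True])"
      by (rule alternatingD[OF compl]) (use r t t' in
        \<open>auto simp: middle_def intro: exI[of _ "_ @ [True]"] exI[of _ "_ @ [False]"]\<close>)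
    have "cycle ((False # False # r @ [True]) @ [True]) ((False # True # s @ [True]) @ [True])
        (False # (False # t @ [False, True]))"
    proof (rule cycle_overlap[OF 1 2])
      fix z z' v v'
      assume z: "z \<in> {False # False # r @ [True], False # True # s @ [True], False # True # s' @ [True]}"
        and z': "z' \<in> {False # r @ [True, True], False # t @ [False, True], False # t' @ [False, True]}"
        and eq: "z @ [v] = v' # z'"
      \<comment> \<open>Each \<open>z'\<close> starts with 0, and only the first choice of
        \<open>z\<close> has 0 as its second letter. Likewise each \<open>z\<close> ends with 1, and
        only the first choice of \<open>z'\<close> has 1 as its last letter but one.\<close>
      have "z ! 1 = z' ! 0"
        using arg_cong[OF eq, of "\<lambda>l. l ! 1"] z by (auto simp: nth_append)
      then have z0: "z = False # False # r @ [True]"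
        using z z' by auto
      have "last (butlast (z @ [v])) = last (butlast (v' # z'))"
        by (simp add: eq)
      then show "z = False # False # r @ [True] \<and> z' = False # r @ [True, True]"
        using z0 z' by (auto simp: butlast_append)
    qed simp_all
    then show ?thesis
      by (simp add: r s t)
  qed
  have ex: "\<exists>l :: bool list. length l = n"
    by (rule exI[of _ "replicate n True"]) simp
  then have T: "alternating (A \<union> B \<union> D)" (is "alternating ?T")
    by (intro alternating_tripartite tri) (auto simp: A_def B_def D_def)
  have lT: "length l = n + 4" if "l \<in> ?T" for l
    using that by (auto simp: A_def B_def D_def)
  have len: "length l = n + 4" if "l \<in> ?T \<union> upd 1 ` ?T" for l
    using that lT by auto
  \<comment> \<open>\<open>u\<close> pads explicit words that the updates at letters 1 and 2 fix,
    namely words with 0 before and 1 after the updated letter.\<close>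
  define u where "u = replicate (n - 2) True"
  have u: "length u = n - 2" "n = Suc (Suc (length u))"
    using n by (auto simp: u_def)
  note ABD = A_def B_def D_def
  have 1: "alternating (?T \<union> upd 1 ` ?T)" (is "alternating ?U")
  proof (rule alternating_upd[OF T lT, where p = "False # False # True # True # u @ [True, True]"
        and q = "False # True # True # True # u @ [True, True]"])
    show "False # False # True # True # u @ [True, True] \<in> ?T"
      by (auto simp: ABD u(2) intro: exI[of _ "True # True # u"])
    show "False # True # True # True # u @ [True, True] \<in> ?T"
      by (auto simp: ABD u(2) intro: exI[of _ "True # True # u"])
  qed (use lT in \<open>auto simp: upd_def\<close>)
  have 2: "alternating (?U \<union> upd 2 ` ?U)"
  proof (rule alternating_upd[OF 1 len, where p = "False # False # True # True # u @ [True, True]"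
        and q = "False # False # False # True # u @ [True, True]"])
    show "False # False # True # True # u @ [True, True] \<in> ?U"
      by (rule UnI1) (auto simp: ABD u(2) intro: exI[of _ "True # True # u"])
    show "False # False # False # True # u @ [True, True] \<in> ?U"
      by (rule UnI1) (auto simp: ABD u(2) intro: exI[of _ "False # True # u"])
  qed (auto simp: upd_def numeral_eq_Suc)
  show ?thesis
  proof (rule alternating_subset[OF 2], rule subsetI)
    fix l assume "l \<in> middle (Suc (Suc n)) False True"
    then obtain s where s: "l = False # s @ [True]" "length s = Suc (Suc n)"
      by (auto simp: middle_def)
    then obtain b s' where "s = b # s'" "length s' = Suc n"
      by (auto simp: length_Suc_conv)
    moreover from this obtain t d where "s' = t @ [d]" "length t = n"
      by (auto simp: length_Suc_conv_rev)
    ultimately have l: "l = False # b # t @ [d, True]" "length t = n"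
      using s by auto
    from \<open>length t = n\<close> u(2) obtain c v where t: "t = c # v" "length v = Suc (length u)"
      by (auto simp: length_Suc_conv)
    have ff: "False # False # t' @ [False, True] \<in> ?T" if "length t' = n" for t'
      using that by (auto simp: ABD)
    \<comment> \<open>The missing words are reached from \<open>D\<close>: the update at letter 1
      turns \<open>000v01\<close> into \<open>010v01\<close>, and the update at letter 2 turns this
      into \<open>011v01\<close>.\<close>
    have ft: "False # True # False # v @ [False, True] \<in> ?U"
    proof -
      have "upd 1 (False # False # False # v @ [False, True]) = False # True # False # v @ [False, True]"
        by (simp add: upd_def)
      then show ?thesis
        using ff[of "False # v"] l t by (metis UnI2 imageI append_Cons length_Cons)
    qed
    have tt: "False # True # True # v @ [False, True] \<in> upd 2 ` ?U"
    proof -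
      have "upd 2 (False # True # False # v @ [False, True]) = False # True # True # v @ [False, True]"
        by (simp add: upd_def numeral_eq_Suc)
      then show ?thesis
        using ft by (metis imageI)
    qed
    show "l \<in> ?U \<union> upd 2 ` ?U"
    proof (cases "b \<and> \<not> d")
      case True
      then show ?thesis
        using ft tt l t by (cases c) auto
    next
      case False
      then have "l \<in> ?T"
        using l by (cases b; cases d) (auto simp: ABD)
      then show ?thesis
        by blast
    qed
  qed
qed

lemma alternating_False_True: "3 \<le> n \<Longrightarrow> alternating (middle n False True)"
proof (induction n rule: nat_induct_at_least)
  case (Suc n)
  then obtain k where "n = Suc k" "2 \<le> k"
    by (cases n) auto
  then show ?case
    using alternating_Suc Suc.IH by simp
qed (rule alternating_base)

text \<open>
  If the boundary bit on the left is 1, then cell 1 is always flipped when updated. Updating inside the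
  window thus never mixes the words \<open>10s\<close> with the words \<open>11s\<close>, so one more cell on the left is needed.
\<close>

lemma alternating_True:
  assumes "3 \<le> n"
  shows "alternating (middle n \<alpha> True)"
proof (cases \<alpha>)
  case True
  have compl: "cycle a b c" if "a \<in> middle k False True" "b \<in> middle k False True" "c \<in> middle k False True"
      "distinct [a, b, c]" "n \<le> k" for a b c k
    using alternatingD[OF alternating_False_True] that assms by (meson le_trans)
  show ?thesis
    unfolding alternating_def
  proof (intro ballI impI)
    fix a b c assume "a \<in> middle n \<alpha> True" "b \<in> middle n \<alpha> True" "c \<in> middle n \<alpha> True"
      and d: "distinct [a, b, c]"
    then obtain r s t where r: "a = True # r @ [True]" "length r = n"
      and s: "b = True # s @ [True]" "length s = n"
      and t: "c = True # t @ [True]" "length t = n"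
      using True by (auto simp: middle_def)
    have m: "y # x @ [True] \<in> middle k y True" if "length x = k" for x y k
      using that by (auto simp: middle_def)
    have m': "y # x # z @ [True] \<in> middle k y True" if "Suc (length z) = k" for x y z k
      using m[of "x # z"] that by simp
    let ?w = "\<lambda>x y z. x # y # z @ [True]"
    \<comment> \<open>Cancelling the prefix 00 from the cycle on the words \<open>0r1\<close> leaves
      the prefix 10; the update at letter 1 turns it into 11, and joining with the prefix 01 removes
      the leading letter.\<close>
    have "cycle (?w True False r) (?w True False s) (?w True False t)"
    proof (rule cycle_split_Cons)
      show "cycle (False # r @ [True]) (False # s @ [True]) (False # t @ [True])"
        by (rule compl[of _ n]) (use r s t d in \<open>auto intro!: m\<close>)
      show "cycle (?w False False r) (?w False False s) (?w False False t)"
        by (rule compl[of _ "Suc n"]) (use r s t d in \<open>auto intro!: m'\<close>)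
    qed simp
    from cycle_image[OF invertible_upd this refl, of 1]
    have "cycle (?w True True r) (?w True True s) (?w True True t)"
      by (simp add: upd_def)
    moreover have "cycle (?w False True r) (?w False True s) (?w False True t)"
      by (rule compl[of _ "Suc n"]) (use r s t d in \<open>auto intro!: m'\<close>)
    ultimately show "cycle a b c"
      unfolding r s t by (rule cycle_join_Cons) simp
  qed
qed (use alternating_False_True assms in auto)

text \<open>The same argument on the right: before a right boundary bit 0 the last inner letter
  always flips. With one more cell on the right, the suffix 10 is split off, changed to 00, and
  joined with the suffix 01.\<close>

lemma alternating_middle:
  assumes "3 \<le> n"
  shows "alternating (middle n \<alpha> \<beta>)"
proof (cases \<beta>)
  case False
  have compl: "cycle a b c" if "a \<in> middle k \<alpha> True" "b \<in> middle k \<alpha> True" "c \<in> middle k \<alpha> True"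
      "distinct [a, b, c]" "n \<le> k" for a b c k
    using alternatingD[OF alternating_True] that assms by (meson le_trans)
  show ?thesis
    unfolding alternating_def
  proof (intro ballI impI)
    fix a b c assume "a \<in> middle n \<alpha> \<beta>" "b \<in> middle n \<alpha> \<beta>" "c \<in> middle n \<alpha> \<beta>"
      and d: "distinct [a, b, c]"
    then obtain r s t where r: "a = \<alpha> # r @ [False]" "length r = n"
      and s: "b = \<alpha> # s @ [False]" "length s = n"
      and t: "c = \<alpha> # t @ [False]" "length t = n"
      using False by (auto simp: middle_def)
    have m: "\<alpha> # x @ [True] \<in> middle k \<alpha> True" if "length x = k" for x k
      using that by (auto simp: middle_def)
    have m': "\<alpha> # z @ [x, True] \<in> middle k \<alpha> True" if "Suc (length z) = k" for x z k
      using m[of "z @ [x]"] that by simp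
    let ?w = "\<lambda>x y z. (\<alpha> # z @ [y]) @ [x]"
    have "cycle (?w False True r) (?w False True s) (?w False True t)"
    proof (rule cycle_split_snoc)
      show "cycle (\<alpha> # r @ [True]) (\<alpha> # s @ [True]) (\<alpha> # t @ [True])"
        by (rule compl[of _ n]) (use r s t d in \<open>auto intro!: m\<close>)
      show "cycle (?w True True r) (?w True True s) (?w True True t)"
        by (rule compl[of _ "Suc n"]) (use r s t d in \<open>auto intro!: m'\<close>)
    qed simp
    note cycle_image[OF invertible_upd this refl, of "Suc n"]
    moreover have "upd (Suc n) (?w False True x) = ?w False False x" if "length x = n" for x
      using that by (simp add: upd_def nth_append list_update_append)
    ultimately have "cycle (?w False False r) (?w False False s) (?w False False t)"
      using r s t by simp
    moreover have "cycle (?w True False r) (?w True False s) (?w True False t)"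
      by (rule compl[of _ "Suc n"]) (use r s t d in \<open>auto intro!: m'\<close>)
    ultimately show "cycle a b c"
      unfolding r s t by (rule cycle_join_snoc) simp
  qed
qed (use alternating_True assms in auto)

subsection \<open>Arbitrary permutations of words\<close>

definition swap2 :: "bool list \<Rightarrow> bool list \<Rightarrow> bool list \<Rightarrow> bool list \<Rightarrow> bool list \<Rightarrow> bool list" where
  "swap2 a b c d l = Transposition.transpose a b (Transposition.transpose c d l)"

lemma length_swap2:
  "length a = n \<Longrightarrow> length b = n \<Longrightarrow> length c = n \<Longrightarrow> length d = n \<Longrightarrow> length l = n \<Longrightarrow>
    length (swap2 a b c d l) = n"
  by (auto simp: swap2_def Transposition.transpose_def)

lemma realized_swap2_middle:
  assumes "a \<in> middle n \<alpha> \<beta>" "b \<in> middle n \<alpha> \<beta>" "c \<in> middle n \<alpha> \<beta>" "d \<in> middle n \<alpha> \<beta>"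
    and d: "distinct [a, b, c, d]" and "3 \<le> n"
  shows "realized (n + 2) (swap2 a b c d)"
proof -
  note compl = alternatingD[OF alternating_middle[OF \<open>3 \<le> n\<close>]]
  \<comment> \<open>A double transposition is a product of two 3-cycles sharing two points.\<close>
  have "cycle c a d" "cycle a b c"
    by (rule compl[of _ \<alpha> \<beta>]; use assms in auto)+
  then have "realized (n + 2) (cyc c a d)" "realized (n + 2) (cyc a b c)"
    using length_middle[OF assms(1)] length_middle[OF assms(3)] by (simp_all add: cycle_def)
  then have "realized (n + 2) (\<lambda>l. cyc c a d (cyc a b c l))"
    by (rule realized_comp)
  then show ?thesis
    by (rule realized_cong) (use d in \<open>auto simp: swap2_def cyc_def Transposition.transpose_def\<close>)
qed

lemma swap2_join_snoc:
  assumes len: "length a = n" "length b = n" "length c = n" "length d = n" and d: "distinct [a, b, c, d]"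
    and r: "\<And>y. realized (Suc n) (swap2 (a @ [y]) (b @ [y]) (c @ [y]) (d @ [y]))"
  shows "realized n (swap2 a b c d)"
proof -
  have "realized (Suc n) (\<lambda>l. swap2 (a @ [True]) (b @ [True]) (c @ [True]) (d @ [True])
      (swap2 (a @ [False]) (b @ [False]) (c @ [False]) (d @ [False]) l))"
    by (rule realized_comp[OF r r])
  then have "realized (Suc n) (\<lambda>l. swap2 a b c d (butlast l) @ [last l])"
  proof (rule realized_cong)
    fix l :: "bool list" assume "length l = Suc n"
    then obtain l' y where "l = l' @ [y]"
      by (cases l rule: rev_cases) auto
    then show "swap2 (a @ [True]) (b @ [True]) (c @ [True]) (d @ [True])
      (swap2 (a @ [False]) (b @ [False]) (c @ [False]) (d @ [False]) l) = swap2 a b c d (butlast l) @ [last l]"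
      using d by (cases y) (auto simp: swap2_def Transposition.transpose_def)
  qed
  then show ?thesis
    using realized_snoc[of n "swap2 a b c d", OF length_swap2[OF len]] by simp
qed

lemma swap2_join_Cons:
  assumes len: "length a = n" "length b = n" "length c = n" "length d = n" and d: "distinct [a, b, c, d]"
    and r: "\<And>y. realized (Suc n) (swap2 (y # a) (y # b) (y # c) (y # d))"
  shows "realized n (swap2 a b c d)"
proof -
  have "realized (Suc n) (\<lambda>l. swap2 (True # a) (True # b) (True # c) (True # d)
      (swap2 (False # a) (False # b) (False # c) (False # d) l))"
    by (rule realized_comp[OF r r])
  then have "realized (Suc n) (\<lambda>l. hd l # swap2 a b c d (tl l))"
  proof (rule realized_cong)
    fix l :: "bool list" assume "length l = Suc n"
    then obtain l' y where "l = y # l'"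
      by (cases l) auto
    then show "swap2 (True # a) (True # b) (True # c) (True # d)
      (swap2 (False # a) (False # b) (False # c) (False # d) l) = hd l # swap2 a b c d (tl l)"
      using d by (cases y) (auto simp: swap2_def Transposition.transpose_def)
  qed
  then show ?thesis
    using realized_Cons[of n "swap2 a b c d", OF length_swap2[OF len]] by simp
qed

text \<open>An additional untouched cell doubles every transposition and thereby makes it even.\<close>

lemma realized_transpose:
  assumes n: "2 \<le> n" and len: "length u = n" "length v = n" and ne: "u \<noteq> v"
  shows "realized n (Transposition.transpose u v)"
proof -
  let ?u = "\<lambda>y. u @ [y]" and ?v = "\<lambda>y. v @ [y]"
  have "realized (Suc n) (swap2 (?u True) (?v True) (?u False) (?v False))"
  \<comment> \<open>A boundary letter on each side places the four words in one
    \<open>middle\<close> set with \<open>n + 1\<close> inner letters, at least 3; joining over both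
    letters removes them again.\<close>
  proof (rule swap2_join_Cons)
    fix \<alpha>
    show "realized (Suc (Suc n)) (swap2 (\<alpha> # ?u True) (\<alpha> # ?v True) (\<alpha> # ?u False) (\<alpha> # ?v False))"
    proof (rule swap2_join_snoc)
      fix \<beta>
      have "realized (Suc n + 2) (swap2 ((\<alpha> # ?u True) @ [\<beta>]) ((\<alpha> # ?v True) @ [\<beta>])
          ((\<alpha> # ?u False) @ [\<beta>]) ((\<alpha> # ?v False) @ [\<beta>]))"
        by (rule realized_swap2_middle[of _ _ \<alpha> \<beta>]) (use n len ne in \<open>auto simp: middle_def\<close>)
      then show "realized (Suc (Suc (Suc n))) (swap2 ((\<alpha> # ?u True) @ [\<beta>]) ((\<alpha> # ?v True) @ [\<beta>])
          ((\<alpha> # ?u False) @ [\<beta>]) ((\<alpha> # ?v False) @ [\<beta>]))"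
        by simp
    qed (use len ne in auto)
  qed (use len ne in auto)
  then have "realized (Suc n) (\<lambda>l. Transposition.transpose u v (butlast l) @ [last l])"
  proof (rule realized_cong)
    fix l :: "bool list" assume "length l = Suc n"
    then obtain l' y where "l = l' @ [y]"
      by (cases l rule: rev_cases) auto
    then show "swap2 (?u True) (?v True) (?u False) (?v False) l = Transposition.transpose u v (butlast l) @ [last l]"
      by (cases y) (auto simp: swap2_def Transposition.transpose_def)
  qed
  moreover have "length (Transposition.transpose u v l) = n" if "length l = n" for l
    using that len by (auto simp: Transposition.transpose_def)
  ultimately show ?thesis
    by (subst (asm) realized_snoc) auto
qed

lemma realized_permutes:
  assumes n: "2 \<le> n" and \<pi>: "\<pi> permutes {l. length l = n}"
  shows "realized n \<pi>"
proof -
  have fin: "finite {l :: bool list. length l = n}"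
    using finite_lists_length_eq[of "UNIV :: bool set" n] by simp
  show ?thesis
    using \<pi> fin
  proof (induction rule: permutes_induct)
    case id
    \<comment> \<open>\<open>H\<close> is only known to be closed under composition, so the identity
      is obtained as the square of a transposition.\<close>
    let ?u = "replicate n True" and ?v = "replicate n False"
    have "?u \<noteq> ?v"
      using n by (cases n) auto
    then have "realized n (Transposition.transpose ?u ?v)"
      by (intro realized_transpose n) simp_all
    note realized_comp[OF this this]
    then show ?case
      by (rule realized_cong) simp
  next
    case (swap a b p)
    then show ?case
      using realized_comp[OF realized_transpose[OF n, of a b] swap.IH] by (simp add: comp_def)
  qed
qed

text \<open>Such a map is the lift of a word map that inherits injectivity; on the finite set of
  words of length \<open>n\<close> it is then a permutation.\<close>

lemma local_injection_mem:
  assumes n: "2 \<le> n" and inj: "inj f"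
    and out: "\<And>x i. i < m \<or> m + int n \<le> i \<Longrightarrow> f x i = x i"
    and dep: "\<And>x y. window m n x = window m n y \<Longrightarrow> window m n (f x) = window m n (f y)"
  shows "f \<in> H"
proof -
  \<comment> \<open>A word is completed to a configuration by zeros; by \<open>dep\<close>, the
    choice outside the window does not affect the result inside.\<close>
  define ext where "ext l = (\<lambda>i. if m \<le> i \<and> i < m + int n then l ! nat (i - m) else False)" for l
  define \<pi> where "\<pi> l = (if length l = n then window m n (f (ext l)) else l)" for l
  have ext: "window m n (ext l) = l" if "length l = n" for l
    by (rule nth_equalityI) (simp_all add: that ext_def)
  have f: "lift m n \<pi> = f"
  proof (intro HOL.ext)
    fix x i
    have "window m n (f (ext (window m n x))) = window m n (f x)"
      by (rule dep) (simp add: ext)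
    then show "lift m n \<pi> x i = f x i"
      by (auto simp: lift_def \<pi>_def out)
  qed
  let ?W = "{l :: bool list. length l = n}"
  have fin: "finite ?W"
    using finite_lists_length_eq[of "UNIV :: bool set" n] by simp
  have "inj_on \<pi> ?W"
  proof (rule inj_onI)
    fix l l' assume W: "l \<in> ?W" "l' \<in> ?W" and eq: "\<pi> l = \<pi> l'"
    have "f (ext l) i = f (ext l') i" for i
    proof (cases "m \<le> i \<and> i < m + int n")
      case True
      then have "nat (i - m) < n" "m + int (nat (i - m)) = i"
        by auto
      then show ?thesis
        using arg_cong[OF eq, of "\<lambda>w. w ! nat (i - m)"] W by (simp add: \<pi>_def)
    next
      case False
      then show ?thesis
        by (auto simp: out ext_def)
    qed
    then have "f (ext l) = f (ext l')"
      by (rule HOL.ext)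
    then have "ext l = ext l'"
      by (rule injD[OF inj])
    then show "l = l'"
      using ext W by (metis mem_Collect_eq)
  qed
  moreover have "\<pi> ` ?W \<subseteq> ?W"
    by (auto simp: \<pi>_def)
  ultimately have "bij_betw \<pi> ?W ?W"
    using endo_inj_surj[OF fin] by (simp add: bij_betw_def)
  then have "\<pi> permutes ?W"
    by (rule bij_imp_permutes) (simp add: \<pi>_def)
  then have "realized n \<pi>"
    by (rule realized_permutes[OF n])
  then show ?thesis
    using f by (auto simp: realized_def)
qed

end

subsection \<open>Gates depend on finitely many cells\<close>

lemma compact_UNIV_config: "compact (UNIV :: config set)"
proof -
  have "compact (UNIV :: bool set)"
    by (rule finite_imp_compact) simp
  then have "compact_space (euclidean :: bool topology)"
    by (simp add: compact_space_def)
  then have "compact_space (product_topology (\<lambda>i :: int. euclidean :: bool topology) UNIV)"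
    by (simp add: compact_space_product_topology)
  then show ?thesis
    by (simp add: compact_space_def euclidean_product_topology)
qed

lemma cylinder_in_open:
  fixes U :: "config set"
  assumes "open U" "x \<in> U"
  shows "\<exists>J. finite J \<and> {y. \<forall>i\<in>J. y i = x i} \<subseteq> U"
proof -
  have "openin (product_topology (\<lambda>i :: int. euclidean :: bool topology) UNIV) U"
    using assms(1) by (simp add: euclidean_product_topology)
  from product_topology_open_contains_basis[OF this assms(2)]
  obtain X where X: "x \<in> Pi\<^sub>E UNIV X" "finite {i. X i \<noteq> UNIV}" "Pi\<^sub>E UNIV X \<subseteq> U"
    unfolding topspace_euclidean by blast
  have "{y. \<forall>i\<in>{i. X i \<noteq> UNIV}. y i = x i} \<subseteq> Pi\<^sub>E UNIV X"
  proof
    fix y assume "y \<in> {y. \<forall>i\<in>{i. X i \<noteq> UNIV}. y i = x i}"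
    then have "y i \<in> X i" for i
      using X(1) by (cases "X i = UNIV") (auto simp: PiE_iff)
    then show "y \<in> Pi\<^sub>E UNIV X"
      by auto
  qed
  with X(3) have "{y. \<forall>i\<in>{i. X i \<noteq> UNIV}. y i = x i} \<subseteq> U"
    by (rule subset_trans[rotated])
  with X(2) show ?thesis
    by (intro exI[of _ "{i. X i \<noteq> UNIV}"] conjI)
qed

lemma open_cylinder: "finite J \<Longrightarrow> open {y :: config. \<forall>i\<in>J. y i = x i}"
proof -
  assume J: "finite J"
  have "open ((\<lambda>y :: config. y i) -` {x i})" for i
    by (rule open_vimage) (simp_all add: open_discrete)
  then have "open (\<Inter>i\<in>J. (\<lambda>y :: config. y i) -` {x i})"
    using J by (intro open_INT) auto
  moreover have "(\<Inter>i\<in>J. (\<lambda>y :: config. y i) -` {x i}) = {y. \<forall>i\<in>J. y i = x i}"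
    by auto
  ultimately show ?thesis
    by simp
qed

text \<open>Around each point \<open>g\<close> is constant on a cylinder; by compactness finitely
  many cylinders cover the space, and the union of their coordinate sets determines
  \<open>g\<close>.\<close>

lemma continuous_finite_dependence:
  fixes g :: "config \<Rightarrow> bool"
  assumes "continuous_on UNIV g"
  shows "\<exists>J. finite J \<and> (\<forall>x y. (\<forall>i\<in>J. x i = y i) \<longrightarrow> g x = g y)"
proof -
  have "open (g -` {g x})" for x
    using assms by (intro open_vimage) (simp_all add: open_discrete)
  then have "\<forall>x. \<exists>J. finite J \<and> {y. \<forall>i\<in>J. y i = x i} \<subseteq> g -` {g x}"
    by (intro allI cylinder_in_open) auto
  from choice[OF this] obtain J
    where *: "\<forall>x. finite (J x) \<and> {y. \<forall>i\<in>J x. y i = x i} \<subseteq> g -` {g x}" ..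
  have J: "finite (J x)" "{y. \<forall>i\<in>J x. y i = x i} \<subseteq> g -` {g x}" for x
    using spec[OF *, of x] by (rule conjunct1, rule conjunct2)
  obtain D where D: "finite D" "UNIV \<subseteq> (\<Union>x\<in>D. {y. \<forall>i\<in>J x. y i = x i})"
    by (rule compactE_image[OF compact_UNIV_config, of UNIV "\<lambda>x. {y. \<forall>i\<in>J x. y i = x i}"])
      (use J(1) in \<open>auto intro: open_cylinder\<close>)
  have "g y = g z" if "\<forall>i\<in>\<Union>(J ` D). y i = z i" for y z
  proof -
    obtain x where x: "x \<in> D" "\<forall>i\<in>J x. y i = x i"
      using D(2) by auto
    then have "\<forall>i\<in>J x. z i = x i"
      using that by auto
    then have "g z = g x"
      using subsetD[OF J(2)[of x], of z] by simp
    moreover have "g y = g x"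
      using subsetD[OF J(2)[of x], of y] x(2) by simp
    ultimately show ?thesis
      by simp
  qed
  moreover have "finite (\<Union>(J ` D))"
    using D(1) J(1) by auto
  ultimately show ?thesis
    by blast
qed

lemma finite_dependence_continuous:
  fixes g :: "config \<Rightarrow> bool"
  assumes J: "finite J" "\<And>x y. (\<forall>i\<in>J. x i = y i) \<Longrightarrow> g x = g y"
  shows "continuous_on UNIV g"
proof -
  have "open (g -` B)" for B
  proof (rule topological_space_class.openI)
    fix x assume x: "x \<in> g -` B"
    have "{y. \<forall>i\<in>J. y i = x i} \<subseteq> g -` B"
    proof
      fix y assume "y \<in> {y. \<forall>i\<in>J. y i = x i}"
      then have "g y = g x"
        by (intro J(2)) simp
      then show "y \<in> g -` B"
        using x by simp
    qed
    then show "\<exists>T. open T \<and> x \<in> T \<and> T \<subseteq> g -` B"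
      using open_cylinder[OF J(1), of x] by (intro exI[of _ "{y. \<forall>i\<in>J. y i = x i}"] conjI) simp_all
  qed
  then show ?thesis
    by (simp add: continuous_on_open_vimage)
qed

lemma is_homeoI:
  assumes "\<And>i. continuous_on UNIV (\<lambda>x. f x i)" "\<And>i. continuous_on UNIV (\<lambda>x. g x i)"
    and "f \<circ> g = id" "g \<circ> f = id"
  shows "is_homeo f"
  unfolding is_homeo_def
proof (intro exI homeomorphismI)
  show "continuous_on UNIV f" "continuous_on UNIV g"
    using assms(1,2) by (auto intro: continuous_on_coordinatewise_then_product)
qed (use assms(3,4) in \<open>auto simp: fun_eq_iff\<close>)

lemma is_homeoD:
  assumes "is_homeo f"
  shows "bij f" "continuous_on UNIV (\<lambda>x. f x i)"
proof -
  obtain g where g: "homeomorphism UNIV UNIV f g"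
    using assms by (auto simp: is_homeo_def)
  then show "bij f"
    by (metis UNIV_I bijI' homeomorphism_apply1 homeomorphism_apply2)
  show "continuous_on UNIV (\<lambda>x. f x i)"
    using g by (auto simp: homeomorphism_def intro: continuous_on_product_then_coordinatewise)
qed

lemma (in rule57) gate_mem:
  assumes "gate f"
  shows "f \<in> H"
proof -
  from assms obtain r :: int where homeo: "is_homeo f" and r: "\<And>x i. \<bar>i\<bar> \<ge> r \<Longrightarrow> f x i = x i"
    by (auto simp: gate_def)
  have "\<forall>i. \<exists>J. finite J \<and> (\<forall>x y. (\<forall>j\<in>J. x j = y j) \<longrightarrow> f x i = f y i)"
    using continuous_finite_dependence is_homeoD(2)[OF homeo] by blast
  from choice[OF this] obtain J
    where "\<forall>i. finite (J i) \<and> (\<forall>x y. (\<forall>j\<in>J i. x j = y j) \<longrightarrow> f x i = f y i)" ..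
  then have J: "finite (J i)" "(\<forall>j\<in>J i. x j = y j) \<Longrightarrow> f x i = f y i" for i x y
    by simp_all
  have "finite (abs ` (\<Union>i\<in>{-r..r}. J i))"
    using J(1) by auto
  then obtain M where "\<forall>a\<in>abs ` (\<Union>i\<in>{-r..r}. J i). a \<le> M"
    using bdd_above_finite unfolding bdd_above_def by blast
  then have M: "\<bar>j\<bar> \<le> M" if "i \<in> {-r..r}" "j \<in> J i" for i j
    using that by blast
  \<comment> \<open>The window from \<open>- N\<close> to \<open>N - 1\<close> must contain all
    altered cells and all cells that these depend on. It is half open, hence \<open>M + 1\<close>;
    the 1 ensures length at least 2.\<close>
  define N where "N = nat (max (M + 1) (max r 1))"
  have N: "M < int N" "r \<le> int N" "1 \<le> N"
    by (auto simp: N_def)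
  show ?thesis
  proof (rule local_injection_mem)
    show "2 \<le> 2 * N" "inj f"
      using N is_homeoD(1)[OF homeo] by (auto simp: bij_def)
    show "f x i = x i" if "i < - int N \<or> - int N + int (2 * N) \<le> i" for x i
      using that N by (intro r) auto
    fix x y :: config
    assume eq: "window (- int N) (2 * N) x = window (- int N) (2 * N) y"
    have xy: "x i = y i" if "- int N \<le> i" "i < int N" for i
      using arg_cong[OF eq, of "\<lambda>l. l ! nat (i + int N)"] that by simp
    show "window (- int N) (2 * N) (f x) = window (- int N) (2 * N) (f y)"
    proof (rule nth_equalityI)
      fix k assume "k < length (window (- int N) (2 * N) (f x))"
      then have k: "k < 2 * N"
        by simp
      have "f x (- int N + int k) = f y (- int N + int k)"
      proof (cases "\<bar>- int N + int k\<bar> \<ge> r")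
        case True
        then show ?thesis
          using k by (simp add: r xy)
      next
        case False
        have "x j = y j" if "j \<in> J (- int N + int k)" for j
        proof (rule xy)
          have "\<bar>j\<bar> \<le> M"
            using False that by (intro M[of "- int N + int k"]) auto
          then show "- int N \<le> j" "j < int N"
            using N by auto
        qed
        then show ?thesis
          by (intro J(2)) blast
      qed
      then show "window (- int N) (2 * N) (f x) ! k = window (- int N) (2 * N) (f y) ! k"
        using k by simp
    qed simp
  qed
qed

subsection \<open>Elementary gates\<close>

text \<open>The word with index \<open>j\<close> has binary value \<open>7 - j\<close>, and digit
  \<open>j\<close> has weight \<open>2 ^ (7 - j)\<close>. The two reversals cancel.\<close>

lemma wolfram_eq:
  "wolfram n x = x(0 := bit n (4 * of_bool (x (- 1)) + 2 * of_bool (x 0) + of_bool (x 1)))"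
proof -
  define k :: nat where "k = 4 * of_bool (x (- 1)) + 2 * of_bool (x 0) + of_bool (x 1)"
  have "(THE j. j < 8 \<and> words ! j = (x (- 1), x 0, x 1)) = 7 - k"
  proof (rule the_equality)
    show "7 - k < 8 \<and> words ! (7 - k) = (x (- 1), x 0, x 1)"
      by (cases "x (- 1)"; cases "x 0"; cases "x 1"; simp add: words_def k_def)
    fix j :: nat assume j: "j < 8 \<and> words ! j = (x (- 1), x 0, x 1)"
    then have "j = 0 \<or> j = 1 \<or> j = 2 \<or> j = 3 \<or> j = 4 \<or> j = 5 \<or> j = 6 \<or> j = 7"
      by linarith
    then show "j = 7 - k"
      using j by (elim disjE) (simp_all add: words_def k_def)
  qed
  moreover have "k \<le> 7"
    by (simp add: k_def)
  ultimately show ?thesis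
    by (simp add: wolfram_def digit_def k_def)
qed

text \<open>Rule 51 flips one cell unconditionally; it is the gate that moves both constant
  configurations.\<close>

lemma wolfram_simps:
  "wolfram 57 x = x(0 := (x 0 \<noteq> (x (- 1) \<or> \<not> x 1)))"
  "wolfram 99 x = x(0 := (x 0 \<noteq> (\<not> x (- 1) \<or> x 1)))"
  "wolfram 51 x = x(0 := (\<not> x 0))"
proof -
  have *: "bit (57 :: nat) (4 * of_bool a + 2 * of_bool b + of_bool c) \<longleftrightarrow> b \<noteq> (a \<or> \<not> c)"
    "bit (99 :: nat) (4 * of_bool a + 2 * of_bool b + of_bool c) \<longleftrightarrow> b \<noteq> (\<not> a \<or> c)"
    "bit (51 :: nat) (4 * of_bool a + 2 * of_bool b + of_bool c) \<longleftrightarrow> \<not> b" for a b c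
    by (cases a; cases b; cases c; simp add: bit_0)+
  show
    "wolfram 57 x = x(0 := (x 0 \<noteq> (x (- 1) \<or> \<not> x 1)))"
    "wolfram 99 x = x(0 := (x 0 \<noteq> (\<not> x (- 1) \<or> x 1)))"
    "wolfram 51 x = x(0 := (\<not> x 0))"
    by (simp_all only: wolfram_eq *)
qed

lemma wolfram_continuous: "continuous_on UNIV (\<lambda>x. wolfram n x i)"
  by (rule finite_dependence_continuous[of "{-1, 0, 1, i}"]) (auto simp: wolfram_eq)

lemma gate_wolframI:
  assumes "\<And>x. wolfram n (wolfram n x) = x"
  shows "gate (wolfram n)"
  unfolding gate_def
proof (intro conjI exI[of _ 1] allI impI)
  show "is_homeo (wolfram n)"
    by (rule is_homeoI[of "wolfram n" "wolfram n", OF wolfram_continuous wolfram_continuous]) (simp_all add: fun_eq_iff assms)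
qed (auto simp: wolfram_eq)

lemma gate_wolfram: "gate (wolfram 57)" "gate (wolfram 99)" "gate (wolfram 51)"
  by (rule gate_wolframI; auto simp: wolfram_simps fun_eq_iff)+

section \<open>Translates and the group generated with the shift\<close>

definition translate :: "int \<Rightarrow> config \<Rightarrow> config" where
  "translate k x = (\<lambda>i. x (i + k))"

lemma translate_1: "translate 1 = shift"
  by (simp add: translate_def shift_def fun_eq_iff)

lemma translate_comp: "translate a \<circ> translate b = translate (a + b)"
  by (simp add: translate_def fun_eq_iff ac_simps)

lemma translate_0: "translate 0 = id"
  by (simp add: translate_def fun_eq_iff)

lemma is_homeo_translate: "is_homeo (translate k)"
proof -
  have "continuous_on UNIV (\<lambda>x. translate a x i)" for a i
    by (rule finite_dependence_continuous[of "{i + a}"]) (auto simp: translate_def)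
  then show ?thesis
    by (intro is_homeoI[of "translate k" "translate (- k)"]) (simp_all add: translate_comp translate_0)
qed

lemma Homeo_simps [simp]:
  "f \<in> carrier Homeo \<longleftrightarrow> is_homeo f" "f \<otimes>\<^bsub>Homeo\<^esub> g = f \<circ> g" "\<one>\<^bsub>Homeo\<^esub> = id"
  by (simp_all add: Homeo_def)

definition wolfram_group :: "nat \<Rightarrow> (config \<Rightarrow> config) set" where
  "wolfram_group n = generate Homeo {wolfram n, shift}"

lemma wolfram_group_comp: "f \<in> wolfram_group n \<Longrightarrow> g \<in> wolfram_group n \<Longrightarrow> f \<circ> g \<in> wolfram_group n"
  using generate.eng[of f Homeo "{wolfram n, shift}" g] by (simp add: wolfram_group_def)

lemma translate_wolfram_group: "translate k \<in> wolfram_group n"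
proof -
  interpret group Homeo by (rule group_Homeo)
  have 1: "translate 1 \<in> wolfram_group n"
    by (auto simp: translate_1 wolfram_group_def intro: generate.incl)
  have "inv\<^bsub>Homeo\<^esub> shift = translate (- 1)"
    using is_homeo_translate by (intro inv_equality) (simp_all add: translate_comp translate_0 flip: translate_1)
  then have 2: "translate (- 1) \<in> wolfram_group n"
    using generate.inv[of shift "{wolfram n, shift}" Homeo] by (simp add: wolfram_group_def)
  show ?thesis
  proof (induction k rule: int_induct[of _ 0])
    case base
    show ?case
      using generate.one[of Homeo "{wolfram n, shift}"]
      unfolding wolfram_group_def translate_0 Homeo_simps .
  next
    case (step1 i)
    then show ?case
      using wolfram_group_comp[OF _ 1] by (metis translate_comp)
  next
    case (step2 i)
    then show ?case
      using wolfram_group_comp[OF _ 2] by (metis translate_comp diff_conv_add_uminus)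
  qed
qed

lemma translated_wolfram: "translate (- i) \<circ> wolfram n \<circ> translate i \<in> wolfram_group n"
  by (intro wolfram_group_comp translate_wolfram_group)
    (auto simp: wolfram_group_def intro: generate.incl)

lemma translated_wolfram_simps:
  "translate (- i) \<circ> wolfram 57 \<circ> translate i = (\<lambda>x. x(i := (x i \<noteq> (x (i - 1) \<or> \<not> x (i + 1)))))"
  "translate (- i) \<circ> wolfram 99 \<circ> translate i = (\<lambda>x. x(i := (x i \<noteq> (\<not> x (i - 1) \<or> x (i + 1)))))"
  by (auto simp: fun_eq_iff translate_def wolfram_simps algebra_simps)

lemma rule57_wolfram_group: "rule57 (wolfram_group 57)"
  by standard (use wolfram_group_comp translated_wolfram[of _ 57] in \<open>simp_all add: translated_wolfram_simps\<close>)

section \<open>Reflection and rule 99\<close>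

definition mirror :: "config \<Rightarrow> config" where
  "mirror x = (\<lambda>i. x (- i))"

lemma mirror_mirror [simp]: "mirror (mirror x) = x"
  by (simp add: mirror_def)

text \<open>Reflection exchanges the neighbours of a cell, so it conjugates rule 57 at cell
  \<open>i\<close> to rule 99 at cell \<open>- i\<close>.\<close>

lemma rule57_mirrored: "rule57 {f. mirror \<circ> f \<circ> mirror \<in> wolfram_group 99}"
proof
  fix f g
  assume "f \<in> {f. mirror \<circ> f \<circ> mirror \<in> wolfram_group 99}" "g \<in> {f. mirror \<circ> f \<circ> mirror \<in> wolfram_group 99}"
  then have "(mirror \<circ> f \<circ> mirror) \<circ> (mirror \<circ> g \<circ> mirror) \<in> wolfram_group 99"
    by (simp add: wolfram_group_comp)
  moreover have "(mirror \<circ> f \<circ> mirror) \<circ> (mirror \<circ> g \<circ> mirror) = mirror \<circ> (f \<circ> g) \<circ> mirror"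
    by (simp add: fun_eq_iff)
  ultimately show "f \<circ> g \<in> {f. mirror \<circ> f \<circ> mirror \<in> wolfram_group 99}"
    by simp
next
  fix i :: int
  have "mirror \<circ> (\<lambda>x. x(i := (x i \<noteq> (x (i - 1) \<or> \<not> x (i + 1))))) \<circ> mirror =
      (\<lambda>x. x(- i := (x (- i) \<noteq> (\<not> x (- i - 1) \<or> x (- i + 1)))))"
  proof (intro ext)
    fix x :: config and j
    have eq: "- (i - 1) = - i + 1" "- (i + 1) = - i - 1" "- j = i \<longleftrightarrow> j = - i"
      by auto
    show "(mirror \<circ> (\<lambda>x. x(i := (x i \<noteq> (x (i - 1) \<or> \<not> x (i + 1))))) \<circ> mirror) x j =
        (x(- i := (x (- i) \<noteq> (\<not> x (- i - 1) \<or> x (- i + 1))))) j"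
      by (simp only: comp_apply mirror_def fun_upd_apply eq minus_minus) auto
  qed
  then show "(\<lambda>x. x(i := (x i \<noteq> (x (i - 1) \<or> \<not> x (i + 1))))) \<in> {f. mirror \<circ> f \<circ> mirror \<in> wolfram_group 99}"
    using translated_wolfram[of "- i" 99] by (simp only: mem_Collect_eq translated_wolfram_simps)
qed

lemma gate_mirror:
  assumes "gate f"
  shows "gate (mirror \<circ> f \<circ> mirror)"
proof -
  have "is_homeo mirror"
  proof -
    have "continuous_on UNIV (\<lambda>x. mirror x i)" for i
      by (rule finite_dependence_continuous[of "{- i}"]) (auto simp: mirror_def)
    then show ?thesis
      by (intro is_homeoI[of mirror mirror]) (auto simp: fun_eq_iff)
  qed
  then have "is_homeo (mirror \<circ> f \<circ> mirror)"
    using assms by (intro is_homeo_comp) (simp_all add: gate_def)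
  moreover obtain r :: int where "\<And>x i. \<bar>i\<bar> \<ge> r \<Longrightarrow> f x i = x i"
    using assms by (auto simp: gate_def)
  then have "\<bar>i\<bar> \<ge> r \<Longrightarrow> (mirror \<circ> f \<circ> mirror) x i = x i" for x i
    by (simp add: mirror_def)
  ultimately show ?thesis
    unfolding gate_def by blast
qed

lemma gate_wolfram_group:
  assumes "gate f" "n \<in> {57, 99}"
  shows "f \<in> wolfram_group n"
proof (cases "n = 57")
  case True
  then show ?thesis
    using rule57.gate_mem[OF rule57_wolfram_group assms(1)] by simp
next
  case False
  have "mirror \<circ> (mirror \<circ> f \<circ> mirror) \<circ> mirror \<in> wolfram_group 99"
    using rule57.gate_mem[OF rule57_mirrored gate_mirror[OF assms(1)]] by simp
  moreover have "mirror \<circ> (mirror \<circ> f \<circ> mirror) \<circ> mirror = f"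
    by (simp add: fun_eq_iff)
  ultimately show ?thesis
    using False assms(2) by simp
qed

lemma universal_gate_wolfram:
  assumes "n \<in> {57, 99}"
  shows "universal_gate (wolfram n)"
proof -
  interpret group Homeo by (rule group_Homeo)
  have gate: "gate (wolfram n)"
    using assms gate_wolfram by auto
  have carrier: "insert shift {f. gate f} \<subseteq> carrier Homeo"
    using is_homeo_translate[of 1] by (auto simp: translate_1 gate_def)
  have "generate Homeo (insert shift {f. gate f}) \<subseteq> wolfram_group n"
    unfolding wolfram_group_def
  proof (rule generate_subgroup_incl)
    show "insert shift {f. gate f} \<subseteq> generate Homeo {wolfram n, shift}"
      using gate_wolfram_group[OF _ assms] by (auto simp: wolfram_group_def intro: generate.incl)
    show "subgroup (generate Homeo {wolfram n, shift}) Homeo"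
      using carrier gate by (intro generate_is_subgroup) auto
  qed
  moreover have "generate Homeo {wolfram n, shift} \<subseteq> generate Homeo (insert shift {f. gate f})"
    by (rule mono_generate) (use gate in auto)
  ultimately show ?thesis
    using gate by (auto simp: universal_gate_def gate_group_def wolfram_group_def)
qed

section \<open>Invariants inherited by the generated group\<close>

lemma generate_Homeo_induct:
  assumes h: "h \<in> generate Homeo S" and S: "S \<subseteq> carrier Homeo"
    and id: "P id" and incl: "\<And>f. f \<in> S \<Longrightarrow> P f"
    and inv: "\<And>f g. f \<in> S \<Longrightarrow> f \<circ> g = id \<Longrightarrow> g \<circ> f = id \<Longrightarrow> P g"
    and comp: "\<And>f g. P f \<Longrightarrow> P g \<Longrightarrow> P (f \<circ> g)"
  shows "P h"
  using h
proof (induction rule: generate.induct)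
  case (inv f)
  interpret group Homeo by (rule group_Homeo)
  have "f \<in> carrier Homeo"
    using inv S by blast
  then have "f \<circ> inv\<^bsub>Homeo\<^esub> f = id" "inv\<^bsub>Homeo\<^esub> f \<circ> f = id"
    using r_inv[of f] l_inv[of f] by simp_all
  then show ?case
    using assms(5) inv by blast
qed (simp_all only: Homeo_simps id incl comp)

lemma universal_gate_mem:
  assumes "universal_gate f" "gate g"
  shows "g \<in> generate Homeo {f, shift}" "{f, shift} \<subseteq> carrier Homeo"
proof -
  have "g \<in> gate_group"
    using assms(2) by (simp add: gate_group_def generate.incl)
  then show "g \<in> generate Homeo {f, shift}"
    using assms(1) by (simp add: universal_gate_def)
  show "{f, shift} \<subseteq> carrier Homeo"
    using assms(1) is_homeo_translate[of 1] by (simp add: universal_gate_def gate_def translate_1)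
qed

text \<open>The shift fixes constant configurations, so a common fixed one would be fixed by the
  whole group, contrary to rule 51.\<close>

lemma universal_gate_not_fixing:
  assumes "universal_gate f"
  shows "f (\<lambda>_. b) \<noteq> (\<lambda>_. b)"
proof
  assume f: "f (\<lambda>_. b) = (\<lambda>_. b)"
  have "wolfram 51 (\<lambda>_. b) = (\<lambda>_. b)"
  proof (rule generate_Homeo_induct[OF universal_gate_mem[OF assms gate_wolfram(3)],
        where P = "\<lambda>h. h (\<lambda>_. b) = (\<lambda>_. b)"])
    show "h (\<lambda>_. b) = (\<lambda>_. b)" if "h \<in> {f, shift}" for h
      using that f by (auto simp: shift_def)
    then show "g (\<lambda>_. b) = (\<lambda>_. b)" if "h \<in> {f, shift}" "g \<circ> h = id" for h g
      using that by (metis comp_apply id_apply)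
  qed simp_all
  then have "wolfram 51 (\<lambda>_. b) 0 = b"
    by simp
  then show False
    by (simp add: wolfram_simps)
qed

text \<open>The affine combination \<open>x + y + z\<close> over the field with two elements;
  preserving it expresses affinity without choosing an origin.\<close>

definition xor3 :: "config \<Rightarrow> config \<Rightarrow> config \<Rightarrow> config" where
  "xor3 x y z = (\<lambda>i. x i \<noteq> (y i \<noteq> z i))"

lemma universal_gate_not_affine:
  assumes "universal_gate f"
  shows "\<exists>x y z. f (xor3 x y z) \<noteq> xor3 (f x) (f y) (f z)"
proof (rule ccontr)
  assume "\<not> ?thesis"
  then have f: "f (xor3 x y z) = xor3 (f x) (f y) (f z)" for x y z
    by blast
  have "\<forall>x y z. wolfram 57 (xor3 x y z) = xor3 (wolfram 57 x) (wolfram 57 y) (wolfram 57 z)"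
  proof (rule generate_Homeo_induct[OF universal_gate_mem[OF assms gate_wolfram(1)],
        where P = "\<lambda>h. \<forall>x y z. h (xor3 x y z) = xor3 (h x) (h y) (h z)"])
    show 1: "\<forall>x y z. h (xor3 x y z) = xor3 (h x) (h y) (h z)" if "h \<in> {f, shift}" for h
      using that f by (auto simp: shift_def xor3_def)
    show "\<forall>x y z. g (xor3 x y z) = xor3 (g x) (g y) (g z)"
      if "h \<in> {f, shift}" "h \<circ> g = id" "g \<circ> h = id" for h g
      using 1[OF that(1)] that(2,3) by (metis comp_apply id_apply)
  qed simp_all
  \<comment> \<open>The control \<open>a\<close> or not \<open>c\<close> of rule 57 is not affine:
    its values at (1,0), (0,1) and (0,0) sum to 0, but its value at (1,1) is 1.\<close>
  then have "wolfram 57 (xor3 (\<lambda>i. i = - 1) (\<lambda>i. i = 1) (\<lambda>_. False)) 0 =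
      xor3 (wolfram 57 (\<lambda>i. i = - 1)) (wolfram 57 (\<lambda>i. i = 1)) (wolfram 57 (\<lambda>_. False)) 0"
    by simp
  then show False
    by (simp add: wolfram_simps xor3_def)
qed

lemma nat_eq_by_bits:
  fixes m n :: nat
  assumes "m < 256" "n < 256" "\<And>k. k < 8 \<Longrightarrow> bit m k = bit n k"
  shows "m = n"
proof -
  have "take_bit 8 m = take_bit 8 n"
    using assms(3) by (intro bit_eqI) (auto simp: bit_take_bit_iff)
  then show ?thesis
    using assms(1,2) by (simp add: take_bit_eq_mod)
qed

theorem theorem3:
  fixes n :: nat
  assumes "n \<in> {0..255}"
  shows "universal_gate (wolfram n) \<longleftrightarrow> n \<in> {57, 99}"
proof
  assume univ: "universal_gate (wolfram n)"
  define e where "e a b c = (\<lambda>i :: int. if i = - 1 then a else if i = 0 then b else if i = 1 then c else False)"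
    for a b c
  have e: "wolfram n (e a b c) = e a (bit n (4 * of_bool a + 2 * of_bool b + of_bool c)) c" for a b c
    by (auto simp: wolfram_eq e_def fun_eq_iff)
  \<comment> \<open>Injectivity: given its neighbours, cell 0 is either kept or flipped.\<close>
  have flip: "bit n (4 * of_bool a + of_bool c) \<noteq> bit n (4 * of_bool a + 2 + of_bool c)" for a c
  proof
    assume "bit n (4 * of_bool a + of_bool c) = bit n (4 * of_bool a + 2 + of_bool c)"
    then have "wolfram n (e a False c) = wolfram n (e a True c)"
      by (simp add: e)
    moreover have "inj (wolfram n)"
      using univ is_homeoD(1) by (auto simp: universal_gate_def gate_def bij_def)
    ultimately have "e a False c = e a True c"
      by (rule injD[rotated])
    then have "e a False c 0 = e a True c 0"
      by simp
    then show False
      by (simp add: e_def)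
  qed
  have b0: "bit n 0" "\<not> bit n 2"
    using universal_gate_not_fixing[OF univ, of False] flip[of False False] by (auto simp: wolfram_eq numeral_2_eq_2)
  have b7: "\<not> bit n 7" "bit n 5"
    using universal_gate_not_fixing[OF univ, of True] flip[of True True] by (auto simp: wolfram_eq)
  have b3: "bit n 3 \<longleftrightarrow> \<not> bit n 1" and b6: "bit n 6 \<longleftrightarrow> \<not> bit n 4"
    using flip[of False True] flip[of True False] by (auto simp: numeral_3_eq_3)
  \<comment> \<open>Moving both constant configurations forces a flip between equal neighbours. Only
    the behaviour for neighbours (1,0) and (0,1), given by bits 4 and 1, remains free.\<close>
  have val: "bit n (4 * of_bool a + 2 * of_bool b + of_bool c) \<longleftrightarrow>
      b \<noteq> (if a = c then True else if a then bit n 4 else bit n 1)" for a b c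
    using b0 b7 b3 b6 by (cases a; cases b; cases c) (auto simp: numeral_2_eq_2 numeral_3_eq_3)
  \<comment> \<open>If these bits agree, the control is the constant 1 or \<open>1 + a + c\<close>,
    and the gate is affine.\<close>
  have b14: "bit n 1 \<noteq> bit n 4"
  proof
    assume "bit n 1 = bit n 4"
    then have "wolfram n (xor3 x y z) = xor3 (wolfram n x) (wolfram n y) (wolfram n z)" for x y z
      unfolding wolfram_eq val by (auto simp: fun_eq_iff xor3_def)
    then show False
      using universal_gate_not_affine[OF univ] by blast
  qed
  have lt: "n < 256"
    using assms by simp
  have less8: "k = 0 \<or> k = 1 \<or> k = 2 \<or> k = 3 \<or> k = 4 \<or> k = 5 \<or> k = 6 \<or> k = 7" if "k < 8" for k :: nat
    using that by linarith
  show "n \<in> {57, 99}"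
  proof (cases "bit n 1")
    case True
    have "n = 99"
    proof (rule nat_eq_by_bits[OF lt])
      fix k :: nat assume "k < 8"
      from less8[OF this] show "bit n k = bit (99 :: nat) k"
        using True b0 b3 b6 b7 b14 by (elim disjE) (simp_all add: bit_0)
    qed simp
    then show ?thesis
      by simp
  next
    case False
    have "n = 57"
    proof (rule nat_eq_by_bits[OF lt])
      fix k :: nat assume "k < 8"
      from less8[OF this] show "bit n k = bit (57 :: nat) k"
        using False b0 b3 b6 b7 b14 by (elim disjE) (simp_all add: bit_0)
    qed simp
    then show ?thesis
      by simp
  qed
qed (rule universal_gate_wolfram)

end
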